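(* Let $A^{G}$ be the symmetric nonnegative adjacency matrix, with $A^{G}_{ii}=0$, of a fixed connected weighted graph on $N$ vertices, and let $F_i(\bm\theta)=\sum_{j}A^{G}_{ij}\sin(\theta_j-\theta_i)$, $i=1,\dots,N$. Let $T>0$, $D>0$, and let $K$ be integrable on $[0,T]$ with $K(t)>0$ for almost every $t$. Put $S(t)=\int_0^tK(u)\,\mathrm du$, $S_T=S(T)$, let $t(s)$ be the inverse of $S$, and $w(s)=1/K(t(s))$. Let $\bm\vartheta(s)$ solve $\frac{\mathrm d\bm\vartheta}{\mathrm ds}=\bm F(\bm\vartheta)$, $\bm\vartheta(0)=\bm\theta_0$, let $A(s)=D\bm F(\bm\vartheta(s))$ be the Jacobian of $\bm F$ along this orbit, and let $M(s,u)$ be the fundamental matrix generated by $A$. Let $\bm\psi$ solve the linear stochastic differential equation (the linearization along $\bm\vartheta$, in the clock $s=S(t)$, of the noisy system $\mathrm d\bm\theta=K(t)\bm F(\bm\theta)\,\mathrm dt+\sqrt{2D}\,\mathrm d\bm W_t$) $$\mathrm d\bm\psi=A(s)\bm\psi\,\mathrm ds+\sqrt{2D\,w(s)}\,\mathrm d\bm B_s,$$ with $\bm B$ a standard $N$-dimensional Brownian motion and with square-integrable initial value $\bm\psi(0)$ independent of $\bm B$ and having covariance matrix $C(0)$. Then the covariance matrix $C(S_T)$ of $\bm\psi(S_T)$ is $$C(S_T)=M(S_T,0)\,C(0)\,M(S_T,0)^{\mathsf T}+2D\int_0^{S_T}w(s)\,M(S_T,s)\,M(S_T,s)^{\mathsf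 T}\,\mathrm ds.$$
   Context: The fundamental matrix $M(s,u)$ is the solution of $\partial_sM(s,u)=A(s)M(s,u)$ with $M(u,u)=I$. The scalar $D>0$ is the noise strength; $D\bm F$ denotes the Jacobian matrix of $\bm F$. *)

theory Defs
  imports "HOL-Probability.Probability"
begin

definition connected_weighted_adjacency :: "real ^ 'n ^ 'n \<Rightarrow> bool" where
  "connected_weighted_adjacency G \<longleftrightarrow>
     transpose G = G \<and>
     (\<forall>i j. 0 \<le> G $ i $ j) \<and>
     (\<forall>i. G $ i $ i = 0) \<and>
     (\<forall>i j. (i, j) \<in> {(k, l). G $ k $ l > 0}\<^sup>*)"

definition coupling_field :: "real ^ 'n ^ 'n \<Rightarrow> real ^ 'n \<Rightarrow> real ^ 'n" where
  "coupling_field G \<theta> = (\<chi> i. \<Sum>j\<in>UNIV. G $ i $ j * sin (\<theta> $ j - \<theta> $ i))"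

definition fundamental_matrix ::
  "(real \<Rightarrow> real ^ 'n ^ 'n) \<Rightarrow> real set \<Rightarrow> (real \<Rightarrow> real \<Rightarrow> real ^ 'n ^ 'n) \<Rightarrow> bool" where
  "fundamental_matrix A I M \<longleftrightarrow>
     (\<forall>u\<in>I. M u u = mat 1 \<and>
        (\<forall>s\<in>I. ((\<lambda>r. M r u) has_vector_derivative A s ** M s u) (at s within I)))"

definition square_integrable :: "'a measure \<Rightarrow> ('a \<Rightarrow> real ^ 'n) \<Rightarrow> bool" where
  "square_integrable P X \<longleftrightarrow>
     X \<in> borel_measurable P \<and> integrable P (\<lambda>\<omega>. (norm (X \<omega>))\<^sup>2)"

definition covariance_matrix :: "'a measure \<Rightarrow> ('a \<Rightarrow> real ^ 'n) \<Rightarrow> real ^ 'n ^ 'n" where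
  "covariance_matrix P X =
     (\<chi> i j. \<integral>\<omega>. (X \<omega> $ i - (\<integral>\<eta>. X \<eta> $ i \<partial>P)) * (X \<omega> $ j - (\<integral>\<eta>. X \<eta> $ j \<partial>P)) \<partial>P)"

(* The last two conjuncts say that B t - B s has law N(0, (t - s) I). *)
definition standard_brownian_motion :: "'a measure \<Rightarrow> (real \<Rightarrow> 'a \<Rightarrow> real ^ 'n) \<Rightarrow> bool" where
  "standard_brownian_motion P B \<longleftrightarrow>
     (\<forall>t\<ge>0. B t \<in> borel_measurable P) \<and>
     (AE \<omega> in P. B 0 \<omega> = 0) \<and>
     (AE \<omega> in P. continuous_on {0..} (\<lambda>t. B t \<omega>)) \<and>
     (\<forall>n (\<tau> :: nat \<Rightarrow> real). 0 \<le> \<tau> 0 \<and> (\<forall>k<n. \<tau> k \<le> \<tau> (Suc k)) \<longrightarrow>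
        prob_space.indep_vars P (\<lambda>_. borel) (\<lambda>k \<omega>. B (\<tau> (Suc k)) \<omega> - B (\<tau> k) \<omega>) {..<n}) \<and>
     (\<forall>s t. 0 \<le> s \<and> s < t \<longrightarrow>
        prob_space.indep_vars P (\<lambda>_. borel) (\<lambda>i \<omega>. (B t \<omega> - B s \<omega>) $ i) UNIV) \<and>
     (\<forall>s t i. 0 \<le> s \<and> s < t \<longrightarrow>
        distributed P lborel (\<lambda>\<omega>. (B t \<omega> - B s \<omega>) $ i) (normal_density 0 (sqrt (t - s))))"

definition independent_of_process ::
  "'a measure \<Rightarrow> ('a \<Rightarrow> real ^ 'n) \<Rightarrow> (real \<Rightarrow> 'a \<Rightarrow> real ^ 'n) \<Rightarrow> bool" where
  "independent_of_process P X B \<longleftrightarrow>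
     prob_space.indep_set P
       (sets (vimage_algebra (space P) X borel))
       (sets (vimage_algebra (space P) (\<lambda>\<omega>. \<lambda>t\<in>{0..}. B t \<omega>) (\<Pi>\<^sub>M t\<in>{0..}. borel)))"

definition is_partition :: "real \<Rightarrow> nat \<Rightarrow> (nat \<Rightarrow> real) \<Rightarrow> bool" where
  "is_partition s n \<tau> \<longleftrightarrow> \<tau> 0 = 0 \<and> \<tau> n = s \<and> (\<forall>k<n. \<tau> k \<le> \<tau> (Suc k))"

definition step_function :: "nat \<Rightarrow> (nat \<Rightarrow> real) \<Rightarrow> (nat \<Rightarrow> real) \<Rightarrow> real \<Rightarrow> real" where
  "step_function n \<tau> c r = (\<Sum>k<n. c k * indicator {\<tau> k<..\<tau> (Suc k)} r)"

definition step_integral ::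
  "(real \<Rightarrow> 'a \<Rightarrow> real ^ 'n) \<Rightarrow> nat \<Rightarrow> (nat \<Rightarrow> real) \<Rightarrow> (nat \<Rightarrow> real) \<Rightarrow> 'a \<Rightarrow> real ^ 'n" where
  "step_integral B n \<tau> c \<omega> = (\<Sum>k<n. c k *\<^sub>R (B (\<tau> (Suc k)) \<omega> - B (\<tau> k) \<omega>))"

(* The stochastic integral of a deterministic integrand f over [0, s]: X is the L2(P)-limit of the
   integrals of step functions converging to f in L2(0, s). By the Ito isometry X does not
   depend, up to null sets, on the approximating sequence. The nonnegative integrals make the
   finiteness of the L2-distances part of the convergence; in particular f is in L2(0, s). *)
definition has_wiener_integral ::
  "'a measure \<Rightarrow> (real \<Rightarrow> 'a \<Rightarrow> real ^ 'n) \<Rightarrow> (real \<Rightarrow> real) \<Rightarrow> real \<Rightarrow> ('a \<Rightarrow> real ^ 'n) \<Rightarrow> bool" where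
  "has_wiener_integral P B f s X \<longleftrightarrow>
     f \<in> borel_measurable (lebesgue_on {0..s}) \<and>
     X \<in> borel_measurable P \<and>
     (\<exists>n \<tau> c.
        (\<forall>m. is_partition s (n m) (\<tau> m)) \<and>
        (\<lambda>m. \<integral>\<^sup>+r. ennreal ((f r - step_function (n m) (\<tau> m) (c m) r)\<^sup>2) \<partial>lebesgue_on {0..s})
          \<longlonglongrightarrow> 0 \<and>
        (\<lambda>m. \<integral>\<^sup>+\<omega>. ennreal ((norm (X \<omega> - step_integral B (n m) (\<tau> m) (c m) \<omega>))\<^sup>2) \<partial>P)
          \<longlonglongrightarrow> 0)"

(* d\<psi> = A \<psi> ds + \<sigma> dB on [0, L], in integrated form. Adaptedness of \<psi> is not required: the noise is
   additive with deterministic coefficient, so the equation makes sense without it, and the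
   solution is anyway determined by \<psi> 0 and the past of B. *)
definition solves_linear_sde ::
  "'a measure \<Rightarrow> (real \<Rightarrow> 'a \<Rightarrow> real ^ 'n) \<Rightarrow> (real \<Rightarrow> real ^ 'n ^ 'n) \<Rightarrow> (real \<Rightarrow> real) \<Rightarrow> real
     \<Rightarrow> (real \<Rightarrow> 'a \<Rightarrow> real ^ 'n) \<Rightarrow> bool" where
  "solves_linear_sde P B A \<sigma> L \<psi> \<longleftrightarrow>
     (\<forall>s\<in>{0..L}. \<psi> s \<in> borel_measurable P) \<and>
     (AE \<omega> in P. continuous_on {0..L} (\<lambda>s. \<psi> s \<omega>)) \<and>
     (AE \<omega> in P. (\<lambda>r. A r *v \<psi> r \<omega>) absolutely_integrable_on {0..L}) \<and>
     (\<forall>s\<in>{0..L}. \<exists>X. has_wiener_integral P B \<sigma> s X \<and>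
        (AE \<omega> in P. \<psi> s \<omega> = \<psi> 0 \<omega> + integral {0..s} (\<lambda>r. A r *v \<psi> r \<omega>) + X \<omega>))"

end

(*
  Fix the Wiener integrals X(s) of sigma = sqrt(2 D w) occurring in the equation. Passing the Ito
  isometry from step functions to the limit shows that X has uncorrelated components and
  uncorrelated increments with variance measure sigma^2 ds, and that X is uncorrelated with psi(0).
  Pathwise, psi - X is differentiable, so variation of constants with M(L, s), L = S(T), and a summation
  by parts exhibit Z = psi(L) - M(L, 0) psi(0) as the almost sure limit of the sums
  sum_k M(L, s_{k+1}) (X(s_{k+1}) - X(s_k)). By orthogonality of increments and Fatou's lemma these sums
  converge in L2, which gives E[Z] = 0, Cov(Z) = int sigma^2 M M^T ds and Cov(psi(0), Z) = 0; no stochastic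
  integral of a matrix-valued function is needed. Finally sigma^2 = 2 D w holds almost everywhere,
  because w > 0 almost everywhere: S transports the measure K(t) dt to Lebesgue measure.
*)
theory Submission
  imports Defs
begin

section \<open>Square-integrable functions\<close>

text \<open>Each X(s) is chosen separately and only up to a null set, so nothing is known about its
  paths, and the equation can be used at countably many times only. Uniform grids suffice: on them X
  agrees almost surely with y(s) = psi(s) - psi(0) - int_0^s A psi, whose paths are continuous. The
  same sums are thus studied twice, pathwise through y and in mean square through the second moments
  of X. Since y need not have bounded variation, all differentiation is moved to M(L, .). The
  fundamental matrix is specified through its first argument; its derivative in the second one comes
  from M(r, u) = M(r, 0) M(0, u) and differentiation of an inverse. The notion of orthogonal
  increments with a variance measure covers both B (Lebesgue measure) and X (density sigma^2), so
  one isometry for step sums serves to pass from B to X and again from X to Z.\<close>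

definition L2 :: "'a measure \<Rightarrow> ('a \<Rightarrow> real) \<Rightarrow> bool" where
  "L2 M f \<longleftrightarrow> f \<in> borel_measurable M \<and> integrable M (\<lambda>x. (f x)\<^sup>2)"

text \<open>The nonnegative integral makes finiteness of the distances part of the convergence,
  exactly as in \<open>has_wiener_integral\<close>. Membership of the limit in L2 is not built in;
  \<open>L2_limit\<close> derives it.\<close>

definition L2_tendsto :: "'a measure \<Rightarrow> (nat \<Rightarrow> 'a \<Rightarrow> real) \<Rightarrow> ('a \<Rightarrow> real) \<Rightarrow> bool" where
  "L2_tendsto M f g \<longleftrightarrow> (\<lambda>n. \<integral>\<^sup>+x. ennreal ((g x - f n x)\<^sup>2) \<partial>M) \<longlonglongrightarrow> 0"

lemma L2_measurable: "L2 M f \<Longrightarrow> f \<in> borel_measurable M"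
  by (simp add: L2_def)

lemma L2_mult_integrable:
  assumes "L2 M f" "L2 M g"
  shows "integrable M (\<lambda>x. f x * g x)"
proof (rule Bochner_Integration.integrable_bound)
  show "integrable M (\<lambda>x. (f x)\<^sup>2 + (g x)\<^sup>2)"
    using assms by (auto simp: L2_def)
  show "(\<lambda>x. f x * g x) \<in> borel_measurable M"
    using assms by (auto simp: L2_def)
  have "\<bar>a * b\<bar> \<le> a\<^sup>2 + b\<^sup>2" for a b :: real
    using sum_squares_bound[of a b] sum_squares_bound[of a "- b"] zero_le_power2[of a] zero_le_power2[of b]
    by (simp only: power2_minus abs_le_iff) linarith
  then show "AE x in M. norm (f x * g x) \<le> norm ((f x)\<^sup>2 + (g x)\<^sup>2)"
    by auto
qed

lemma L2_add:
  assumes "L2 M f" "L2 M g"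
  shows "L2 M (\<lambda>x. f x + g x)"
proof -
  have "integrable M (\<lambda>x. (f x)\<^sup>2 + (g x)\<^sup>2 + 2 * (f x * g x))"
    using assms L2_mult_integrable[OF assms] by (auto simp: L2_def)
  then show ?thesis
    using assms by (auto simp: L2_def power2_sum mult.assoc)
qed

lemma L2_cmult: "L2 M f \<Longrightarrow> L2 M (\<lambda>x. c * f x)"
  by (auto simp: L2_def power_mult_distrib)

lemma L2_diff:
  assumes "L2 M f" "L2 M g"
  shows "L2 M (\<lambda>x. f x - g x)"
  using L2_add[OF assms(1) L2_cmult[OF assms(2), of "-1"]] by simp

lemma L2_zero: "L2 M (\<lambda>x. 0)"
  by (simp add: L2_def)

lemma L2_sum:
  assumes "\<And>i. i \<in> I \<Longrightarrow> L2 M (f i)"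
  shows "L2 M (\<lambda>x. \<Sum>i\<in>I. f i x)"
  using assms
proof (induction I rule: infinite_finite_induct)
  case (insert i I)
  then show ?case
    using L2_add[of M "f i" "\<lambda>x. \<Sum>i\<in>I. f i x"] by auto
qed (auto simp: L2_zero)

lemma L2_cong_AE:
  assumes "L2 M f" "g \<in> borel_measurable M" "AE x in M. f x = g x"
  shows "L2 M g"
proof -
  have "integrable M (\<lambda>x. (f x)\<^sup>2) \<longleftrightarrow> integrable M (\<lambda>x. (g x)\<^sup>2)"
    using assms by (intro integrable_cong_AE) (auto simp: L2_def)
  then show ?thesis using assms by (auto simp: L2_def)
qed

lemma L2_bounded:
  assumes "finite_measure M" "f \<in> borel_measurable M" "AE x in M. \<bar>f x\<bar> \<le> C"
  shows "L2 M f"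
proof -
  have "integrable M (\<lambda>x. (f x)\<^sup>2)"
  proof (rule finite_measure.integrable_const_bound[OF assms(1), where B = "C\<^sup>2"])
    have "\<bar>a\<bar> \<le> C \<Longrightarrow> a\<^sup>2 \<le> C\<^sup>2" for a :: real
      by (metis abs_ge_zero power2_abs power_mono)
    then show "AE x in M. norm ((f x)\<^sup>2) \<le> C\<^sup>2" using assms(3) by auto
  qed (use assms in auto)
  then show ?thesis using assms by (auto simp: L2_def)
qed

text \<open>Discriminant argument: the integral of (f + t g)^2 is a quadratic in t that is never
  negative, and the bound is its value at the minimizer t = - b / c.\<close>

lemma L2_Cauchy_Schwarz:
  assumes "L2 M f" "L2 M g"
  shows "(\<integral>x. f x * g x \<partial>M)\<^sup>2 \<le> (\<integral>x. (f x)\<^sup>2 \<partial>M) * (\<integral>x. (g x)\<^sup>2 \<partial>M)"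
proof -
  define a b c where "a = (\<integral>x. (f x)\<^sup>2 \<partial>M)" and "b = (\<integral>x. f x * g x \<partial>M)" and "c = (\<integral>x. (g x)\<^sup>2 \<partial>M)"
  have int: "integrable M (\<lambda>x. (f x)\<^sup>2)" "integrable M (\<lambda>x. f x * g x)" "integrable M (\<lambda>x. (g x)\<^sup>2)"
    using assms L2_mult_integrable[OF assms] by (auto simp: L2_def)
  have quad: "0 \<le> a + 2 * t * b + t\<^sup>2 * c" for t
  proof -
    have "(\<integral>x. (f x + t * g x)\<^sup>2 \<partial>M) = (\<integral>x. (f x)\<^sup>2 + 2 * t * (f x * g x) + t\<^sup>2 * (g x)\<^sup>2 \<partial>M)"
      by (intro Bochner_Integration.integral_cong) (auto simp: power2_eq_square algebra_simps)
    also have "\<dots> = a + 2 * t * b + t\<^sup>2 * c"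
      using int by (simp add: a_def b_def c_def)
    finally show ?thesis
      by (metis (no_types, lifting) integral_nonneg_AE always_eventually zero_le_power2)
  qed
  have "c \<ge> 0" by (simp add: c_def)
  have "b\<^sup>2 \<le> a * c"
  proof (cases "c = 0")
    case True
    \<comment> \<open>For c = 0 the quadratic is affine in t; if b were nonzero, the chosen t would
      give it the value -1.\<close>
    have "b = 0"
      using quad[of "- (a + 1) / (2 * b)"] True by (cases "b = 0") (auto simp: field_simps)
    then show ?thesis using True by simp
  next
    case False
    then have "c > 0" using \<open>c \<ge> 0\<close> by simp
    then show ?thesis
      using quad[of "- b / c"] by (simp add: field_simps power2_eq_square)
  qed
  then show ?thesis by (simp add: a_def b_def c_def)
qed

section \<open>Convergence in mean square\<close>

lemma L2_of_nn_integral_finite: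
  assumes "f \<in> borel_measurable M" "(\<integral>\<^sup>+x. ennreal ((f x)\<^sup>2) \<partial>M) < \<infinity>"
  shows "L2 M f"
  using assms by (auto simp: L2_def integrable_iff_bounded)

lemma L2_nn_integral:
  assumes "L2 M f"
  shows "(\<integral>\<^sup>+x. ennreal ((f x)\<^sup>2) \<partial>M) = ennreal (\<integral>x. (f x)\<^sup>2 \<partial>M)"
  using assms by (intro nn_integral_eq_integral) (auto simp: L2_def)

text \<open>A single approximation at distance below 1 is enough: g is the sum of g - f n and f n,
  both in L2.\<close>

lemma L2_limit:
  assumes "\<And>n. L2 M (f n)" "g \<in> borel_measurable M" "L2_tendsto M f g"
  shows "L2 M g"
proof -
  have "eventually (\<lambda>n. (\<integral>\<^sup>+x. ennreal ((g x - f n x)\<^sup>2) \<partial>M) < 1) sequentially"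
    using assms(3) unfolding L2_tendsto_def by (rule order_tendstoD) simp
  then obtain n where n: "(\<integral>\<^sup>+x. ennreal ((g x - f n x)\<^sup>2) \<partial>M) < 1"
    by (meson eventually_happens' sequentially_bot)
  have "L2 M (\<lambda>x. g x - f n x)"
    by (rule L2_of_nn_integral_finite)
      (use n assms(1)[of n] assms(2) in \<open>auto simp: L2_def intro: less_trans\<close>)
  from L2_add[OF this assms(1)[of n]] show ?thesis by simp
qed

lemma L2_tendsto_iff:
  assumes "\<And>n. L2 M (f n)" "L2 M g"
  shows "L2_tendsto M f g \<longleftrightarrow> (\<lambda>n. \<integral>x. (g x - f n x)\<^sup>2 \<partial>M) \<longlonglongrightarrow> 0"
  unfolding L2_tendsto_def
  using L2_nn_integral[OF L2_diff[OF assms(2) assms(1)]]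
  by (simp flip: ennreal_0)

text \<open>With the errors u = f' - f n and v = g' - g n, the product f n g n equals f' g' - u g' -
  f' v + u v, and Cauchy-Schwarz sends the integrals of the last three terms to 0.\<close>

lemma L2_tendsto_inner:
  assumes f: "\<And>n. L2 M (f n)" "L2 M f'" "L2_tendsto M f f'"
    and g: "\<And>n. L2 M (g n)" "L2 M g'" "L2_tendsto M g g'"
  shows "(\<lambda>n. \<integral>x. f n x * g n x \<partial>M) \<longlonglongrightarrow> (\<integral>x. f' x * g' x \<partial>M)"
proof -
  define u where "u n x = f' x - f n x" for n x
  define v where "v n x = g' x - g n x" for n x
  have u: "L2 M (u n)" and v: "L2 M (v n)" for n
    unfolding u_def v_def using f g by (auto intro: L2_diff)
  have ul: "(\<lambda>n. \<integral>x. (u n x)\<^sup>2 \<partial>M) \<longlonglongrightarrow> 0" and vl: "(\<lambda>n. \<integral>x. (v n x)\<^sup>2 \<partial>M) \<longlonglongrightarrow> 0"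
    using f g by (auto simp: L2_tendsto_iff u_def v_def)
  have small: "(\<lambda>n. \<integral>x. p n x * q n x \<partial>M) \<longlonglongrightarrow> 0"
    if p: "\<And>n. L2 M (p n)" and q: "\<And>n. L2 M (q n)"
      and lim: "(\<lambda>n. (\<integral>x. (p n x)\<^sup>2 \<partial>M) * (\<integral>x. (q n x)\<^sup>2 \<partial>M)) \<longlonglongrightarrow> 0" for p q
  proof -
    have "(\<lambda>n. (\<integral>x. p n x * q n x \<partial>M)\<^sup>2) \<longlonglongrightarrow> 0"
      by (rule tendsto_sandwich[OF _ _ tendsto_const lim])
        (use L2_Cauchy_Schwarz[OF p q] in auto)
    from tendsto_real_sqrt[OF this] show ?thesis by (simp add: tendsto_rabs_zero_iff)
  qed
  have 1: "(\<lambda>n. \<integral>x. u n x * g' x \<partial>M) \<longlonglongrightarrow> 0"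
    by (rule small) (use u g tendsto_mult_right[OF ul, of "\<integral>x. (g' x)\<^sup>2 \<partial>M"] in \<open>auto simp: mult.commute\<close>)
  have 2: "(\<lambda>n. \<integral>x. f' x * v n x \<partial>M) \<longlonglongrightarrow> 0"
    by (rule small) (use v f tendsto_mult_left[OF vl, of "\<integral>x. (f' x)\<^sup>2 \<partial>M"] in auto)
  have 3: "(\<lambda>n. \<integral>x. u n x * v n x \<partial>M) \<longlonglongrightarrow> 0"
    by (rule small) (use u v tendsto_mult[OF ul vl] in auto)
  have "(\<integral>x. f n x * g n x \<partial>M) = (\<integral>x. f' x * g' x \<partial>M) - (\<integral>x. u n x * g' x \<partial>M)
      - (\<integral>x. f' x * v n x \<partial>M) + (\<integral>x. u n x * v n x \<partial>M)" for n
  proof -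
    have i: "integrable M (\<lambda>x. f' x * g' x)" "integrable M (\<lambda>x. u n x * g' x)"
        "integrable M (\<lambda>x. f' x * v n x)" "integrable M (\<lambda>x. u n x * v n x)"
      using f g u v by (auto intro: L2_mult_integrable)
    have "(\<integral>x. f n x * g n x \<partial>M) = (\<integral>x. f' x * g' x - u n x * g' x - f' x * v n x + u n x * v n x \<partial>M)"
      by (intro Bochner_Integration.integral_cong) (auto simp: u_def v_def algebra_simps)
    then show ?thesis using i by simp
  qed
  moreover have "(\<lambda>n. (\<integral>x. f' x * g' x \<partial>M) - (\<integral>x. u n x * g' x \<partial>M)
      - (\<integral>x. f' x * v n x \<partial>M) + (\<integral>x. u n x * v n x \<partial>M)) \<longlonglongrightarrow> (\<integral>x. f' x * g' x \<partial>M) - 0 - 0 + 0"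
    by (intro tendsto_intros 1 2 3)
  ultimately show ?thesis by simp
qed

lemma L2_tendsto_const: "L2_tendsto M (\<lambda>_. f) f"
  by (simp add: L2_tendsto_def)

text \<open>Almost everywhere (g - f n)^2 is the limit of (f m - f n)^2 as m grows, so Fatou bounds
  its integral by the Cauchy estimate. An almost sure limit thus becomes a mean square limit without
  any dominating function.\<close>

lemma L2_Fatou:
  assumes f: "\<And>n. L2 M (f n)" and g: "g \<in> borel_measurable M"
    and lim: "AE x in M. (\<lambda>n. f n x) \<longlonglongrightarrow> g x"
    and Cauchy: "\<And>e. e > 0 \<Longrightarrow> \<exists>N. \<forall>n\<ge>N. \<forall>m\<ge>N. (\<integral>x. (f m x - f n x)\<^sup>2 \<partial>M) \<le> e"
  shows "L2_tendsto M f g"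
  unfolding L2_tendsto_def
proof (rule tendsto_zero_ennreal)
  fix e :: real assume "0 < e"
  \<comment> \<open>Half of e, because Fatou yields a weak inequality and a strict one is
    required.\<close>
  then obtain N where N: "\<forall>n\<ge>N. \<forall>m\<ge>N. (\<integral>x. (f m x - f n x)\<^sup>2 \<partial>M) \<le> e / 2"
    using Cauchy[of "e / 2"] by auto
  have "(\<integral>\<^sup>+x. ennreal ((g x - f n x)\<^sup>2) \<partial>M) < ennreal e" if n: "n \<ge> N" for n
  proof -
    have "(\<integral>\<^sup>+x. ennreal ((g x - f n x)\<^sup>2) \<partial>M) = (\<integral>\<^sup>+x. liminf (\<lambda>m. ennreal ((f m x - f n x)\<^sup>2)) \<partial>M)"
    proof (intro nn_integral_cong_AE, use lim in eventually_elim)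
      fix x assume "(\<lambda>n. f n x) \<longlonglongrightarrow> g x"
      then have "(\<lambda>m. ennreal ((f m x - f n x)\<^sup>2)) \<longlonglongrightarrow> ennreal ((g x - f n x)\<^sup>2)"
        by (intro tendsto_ennrealI tendsto_intros)
      then show "ennreal ((g x - f n x)\<^sup>2) = liminf (\<lambda>m. ennreal ((f m x - f n x)\<^sup>2))"
        by (intro lim_imp_Liminf[symmetric]) auto
    qed
    also have "\<dots> \<le> liminf (\<lambda>m. \<integral>\<^sup>+x. ennreal ((f m x - f n x)\<^sup>2) \<partial>M)"
      using L2_measurable[OF L2_diff[OF f f]]
      by (intro nn_integral_liminf measurable_compose[OF _ measurable_ennreal] borel_measurable_power)
    also have "\<dots> \<le> limsup (\<lambda>m. \<integral>\<^sup>+x. ennreal ((f m x - f n x)\<^sup>2) \<partial>M)"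
      by (intro Liminf_le_Limsup) auto
    also have "\<dots> \<le> ennreal (e / 2)"
      using L2_nn_integral[OF L2_diff[OF f f]] N n
      by (intro Limsup_bounded) (auto simp: eventually_sequentially intro!: exI[of _ N] ennreal_leI)
    also have "\<dots> < ennreal e"
      using \<open>0 < e\<close> by (simp add: ennreal_less_iff)
    finally show ?thesis .
  qed
  then show "\<forall>\<^sub>F n in sequentially. (\<integral>\<^sup>+x. ennreal ((g x - f n x)\<^sup>2) \<partial>M) < ennreal e"
    by (auto simp: eventually_sequentially)
qed

lemma (in finite_measure) L2_integrable: "L2 M f \<Longrightarrow> integrable M f"
  by (auto simp: L2_def intro: square_integrable_imp_integrable)

section \<open>Processes with orthogonal increments\<close>

lemma L2_inner_sum:
  assumes "\<And>k. k \<in> I \<Longrightarrow> L2 M (f k)" "\<And>l. l \<in> J \<Longrightarrow> L2 M (g l)"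
  shows "(\<integral>x. (\<Sum>k\<in>I. a k * f k x) * (\<Sum>l\<in>J. b l * g l x) \<partial>M) =
    (\<Sum>k\<in>I. \<Sum>l\<in>J. a k * b l * (\<integral>x. f k x * g l x \<partial>M))"
proof -
  have "(\<integral>x. (\<Sum>k\<in>I. a k * f k x) * (\<Sum>l\<in>J. b l * g l x) \<partial>M) =
      (\<integral>x. (\<Sum>k\<in>I. \<Sum>l\<in>J. a k * b l * (f k x * g l x)) \<partial>M)"
    by (intro Bochner_Integration.integral_cong) (auto simp: sum_product mult_ac)
  then show ?thesis
    using L2_mult_integrable[OF assms] by (simp add: Bochner_Integration.integral_sum)
qed

text \<open>Both sides are bilinear in the coefficients, so it suffices to compare inner products of
  generators. The factor c will be 1 for equal and 0 for distinct components of the process.\<close>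

lemma L2_bilinear_isometry:
  assumes "\<And>k. k \<in> I \<Longrightarrow> L2 P (U k)" "\<And>l. l \<in> J \<Longrightarrow> L2 P (V l)"
    and "\<And>k. k \<in> I \<Longrightarrow> L2 \<mu> (u k)" "\<And>l. l \<in> J \<Longrightarrow> L2 \<mu> (v l)"
    and eq: "\<And>k l. k \<in> I \<Longrightarrow> l \<in> J \<Longrightarrow> (\<integral>x. U k x * V l x \<partial>P) = c * (\<integral>x. u k x * v l x \<partial>\<mu>)"
  shows "(\<integral>x. (\<Sum>k\<in>I. a k * U k x) * (\<Sum>l\<in>J. b l * V l x) \<partial>P) =
    c * (\<integral>x. (\<Sum>k\<in>I. a k * u k x) * (\<Sum>l\<in>J. b l * v l x) \<partial>\<mu>)"
proof -
  have "(\<Sum>k\<in>I. \<Sum>l\<in>J. a k * b l * (\<integral>x. U k x * V l x \<partial>P)) =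
      c * (\<Sum>k\<in>I. \<Sum>l\<in>J. a k * b l * (\<integral>x. u k x * v l x \<partial>\<mu>))"
    using eq by (simp add: sum_distrib_left mult_ac)
  then show ?thesis
    by (simp only: L2_inner_sum[OF assms(1,2)] L2_inner_sum[OF assms(3,4)])
qed

text \<open>A process on \<open>[0, L]\<close> with uncorrelated components and uncorrelated increments;
  \<open>\<mu>\<close> plays the role of the quadratic variation measure of each component.\<close>

definition orthogonal_increments ::
  "'a measure \<Rightarrow> (real \<Rightarrow> 'a \<Rightarrow> real ^ 'n) \<Rightarrow> real \<Rightarrow> real measure \<Rightarrow> bool" where
  "orthogonal_increments P Y L \<mu> \<longleftrightarrow>
     (\<forall>s\<in>{0..L}. L2 \<mu> (indicator {0<..s})) \<and>
     (\<forall>s\<in>{0..L}. \<forall>i. L2 P (\<lambda>\<omega>. Y s \<omega> $ i)) \<and>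
     (\<forall>s\<in>{0..L}. \<forall>r\<in>{0..L}. \<forall>i j. (\<integral>\<omega>. Y s \<omega> $ i * Y r \<omega> $ j \<partial>P) =
        (if i = j then 1 else 0) * (\<integral>x. indicator {0<..s} x * indicator {0<..r} x \<partial>\<mu>))"

section \<open>Step functions and step integrals over partitions\<close>

lemma partition_mono:
  assumes "is_partition s n \<tau>" "j \<le> k" "k \<le> n"
  shows "\<tau> j \<le> \<tau> k"
  using assms(2,3)
proof (induction k rule: dec_induct)
  case (step k)
  then have "\<tau> k \<le> \<tau> (Suc k)" using assms(1) by (auto simp: is_partition_def)
  then show ?case using step by auto
qed auto

lemma partition_bounds:
  assumes "is_partition s n \<tau>" "k \<le> n"
  shows "0 \<le> \<tau> k" "\<tau> k \<le> s"
  using partition_mono[OF assms(1), of 0 k] partition_mono[OF assms(1), of k n] assms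
  by (auto simp: is_partition_def)

lemma step_integral_nth:
  "step_integral Y n \<tau> c \<omega> $ i = (\<Sum>k<n. c k * (Y (\<tau> (Suc k)) \<omega> $ i - Y (\<tau> k) \<omega> $ i))"
  by (simp add: step_integral_def)

text \<open>The counterpart of an increment Y b - Y a: in the isometry, \<open>Y s\<close>
  corresponds to the indicator of \<open>{0<..s}\<close>.\<close>

lemma indicator_half_open:
  fixes a b x :: real
  shows "0 \<le> a \<Longrightarrow> a \<le> b \<Longrightarrow>
    (indicator {a<..b} x :: real) = indicator {0<..b} x - indicator {0<..a} x"
  by (auto simp: indicator_def)

lemma L2_step_function:
  assumes "orthogonal_increments P Y L \<mu>" "is_partition s n \<tau>" "s \<le> L"
  shows "L2 \<mu> (step_function n \<tau> c)"
proof -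
  have "L2 \<mu> (indicator {\<tau> k<..\<tau> (Suc k)})" if "k < n" for k
  proof -
    have b: "0 \<le> \<tau> k" "\<tau> k \<le> \<tau> (Suc k)" "\<tau> k \<in> {0..L}" "\<tau> (Suc k) \<in> {0..L}"
      using partition_bounds[OF assms(2), of k] partition_bounds[OF assms(2), of "Suc k"]
        that assms(2,3) by (auto simp: is_partition_def)
    then have "L2 \<mu> (\<lambda>x. indicator {0<..\<tau> (Suc k)} x - indicator {0<..\<tau> k} x)"
      using assms(1) by (intro L2_diff) (auto simp: orthogonal_increments_def)
    moreover have "(\<lambda>x. indicator {0<..\<tau> (Suc k)} x - indicator {0<..\<tau> k} x :: real) = indicator {\<tau> k<..\<tau> (Suc k)}"
      using indicator_half_open[OF b(1,2)] by auto
    ultimately show ?thesis by simp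
  qed
  then show ?thesis
    unfolding step_function_def[abs_def] by (intro L2_sum L2_cmult) auto
qed

lemma L2_step_integral:
  assumes "orthogonal_increments P Y L \<mu>" "is_partition s n \<tau>" "s \<le> L"
  shows "L2 P (\<lambda>\<omega>. step_integral Y n \<tau> c \<omega> $ i)"
proof -
  have "L2 P (\<lambda>\<omega>. Y (\<tau> (Suc k)) \<omega> $ i - Y (\<tau> k) \<omega> $ i)" if "k < n" for k
    using partition_bounds[OF assms(2), of k] partition_bounds[OF assms(2), of "Suc k"] that assms
    by (intro L2_diff) (auto simp: orthogonal_increments_def)
  then show ?thesis
    unfolding step_integral_nth by (intro L2_sum L2_cmult) auto
qed

text \<open>Polarized Ito isometry for two unrelated partitions. Expanding both sums into
  increments, and each increment into values \<open>Y s\<close>, reduces it to the covariances in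
  \<open>orthogonal_increments\<close> and avoids a common refinement.\<close>

lemma step_integral_isometry:
  assumes Y: "orthogonal_increments P Y L \<mu>"
    and p: "is_partition s n \<tau>" "s \<le> L" and p': "is_partition r n' \<tau>'" "r \<le> L"
  shows "(\<integral>\<omega>. step_integral Y n \<tau> c \<omega> $ i * step_integral Y n' \<tau>' c' \<omega> $ j \<partial>P) =
    (if i = j then 1 else 0) * (\<integral>x. step_function n \<tau> c x * step_function n' \<tau>' c' x \<partial>\<mu>)"
proof -
  let ?e = "if i = j then 1 else 0 :: real"
  have in_L: "\<tau> k \<in> {0..L}" if "k \<le> n" for k
    using partition_bounds[OF p(1) that] p(2) by auto
  have in_L': "\<tau>' k \<in> {0..L}" if "k \<le> n'" for k
    using partition_bounds[OF p'(1) that] p'(2) by auto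
  have ind: "indicator {\<tau> k<..\<tau> (Suc k)} x = (indicator {0<..\<tau> (Suc k)} x - indicator {0<..\<tau> k} x :: real)"
    if "k < n" for k x
    using that p(1) in_L[of k] by (intro indicator_half_open) (auto simp: is_partition_def)
  have ind': "indicator {\<tau>' k<..\<tau>' (Suc k)} x = (indicator {0<..\<tau>' (Suc k)} x - indicator {0<..\<tau>' k} x :: real)"
    if "k < n'" for k x
    using that p'(1) in_L'[of k] by (intro indicator_half_open) (auto simp: is_partition_def)
  have LY: "L2 P (\<lambda>\<omega>. Y s \<omega> $ i)" and Lind: "L2 \<mu> (indicator {0<..s})" if "s \<in> {0..L}" for s i
    using Y that by (auto simp: orthogonal_increments_def)
  have cov: "(\<integral>\<omega>. Y s \<omega> $ i * Y r \<omega> $ j \<partial>P) = ?e * (\<integral>x. indicator {0<..s} x * indicator {0<..r} x \<partial>\<mu>)"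
    if "s \<in> {0..L}" "r \<in> {0..L}" for s r
    using Y that by (auto simp: orthogonal_increments_def)
  have incr: "(\<integral>\<omega>. (Y b \<omega> $ i - Y a \<omega> $ i) * (Y b' \<omega> $ j - Y a' \<omega> $ j) \<partial>P) =
      ?e * (\<integral>x. (indicator {0<..b} x - indicator {0<..a} x) * (indicator {0<..b'} x - indicator {0<..a'} x) \<partial>\<mu>)"
    if *: "a \<in> {0..L}" "b \<in> {0..L}" "a' \<in> {0..L}" "b' \<in> {0..L}" for a b a' b'
    using L2_mult_integrable[OF LY LY] L2_mult_integrable[OF Lind Lind] *
    by (simp add: left_diff_distrib right_diff_distrib cov)
  have "(\<integral>\<omega>. (\<Sum>k<n. c k * (Y (\<tau> (Suc k)) \<omega> $ i - Y (\<tau> k) \<omega> $ i)) *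
        (\<Sum>k<n'. c' k * (Y (\<tau>' (Suc k)) \<omega> $ j - Y (\<tau>' k) \<omega> $ j)) \<partial>P) =
      ?e * (\<integral>x. (\<Sum>k<n. c k * (indicator {0<..\<tau> (Suc k)} x - indicator {0<..\<tau> k} x)) *
        (\<Sum>k<n'. c' k * (indicator {0<..\<tau>' (Suc k)} x - indicator {0<..\<tau>' k} x)) \<partial>\<mu>)"
    by (intro L2_bilinear_isometry L2_diff LY Lind incr in_L in_L') auto
  then show ?thesis
    by (simp add: step_integral_nth step_function_def ind ind')
qed

text \<open>Orthogonality to every \<open>Y s\<close> passes to linear combinations. The intended g
  are the constant 1, which gives means, and the components of the initial value, which give cross
  covariances.\<close>

lemma step_integral_orthogonal:
  assumes Y: "orthogonal_increments P Y L \<mu>" and p: "is_partition s n \<tau>" "s \<le> L"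
    and g: "L2 P g" and orth: "\<And>s. s \<in> {0..L} \<Longrightarrow> (\<integral>\<omega>. g \<omega> * Y s \<omega> $ i \<partial>P) = 0"
  shows "(\<integral>\<omega>. g \<omega> * step_integral Y n \<tau> c \<omega> $ i \<partial>P) = 0"
proof -
  have in_L: "\<tau> k \<in> {0..L}" if "k \<le> n" for k
    using partition_bounds[OF p(1) that] p(2) by auto
  have int: "integrable P (\<lambda>\<omega>. g \<omega> * Y s \<omega> $ i)" if "s \<in> {0..L}" for s
    using Y g that by (intro L2_mult_integrable) (auto simp: orthogonal_increments_def)
  have "(\<integral>\<omega>. g \<omega> * step_integral Y n \<tau> c \<omega> $ i \<partial>P) =
      (\<integral>\<omega>. (\<Sum>k<n. c k * (g \<omega> * Y (\<tau> (Suc k)) \<omega> $ i - g \<omega> * Y (\<tau> k) \<omega> $ i)) \<partial>P)"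
    by (simp add: step_integral_nth sum_distrib_left algebra_simps)
  also have "\<dots> = (\<Sum>k<n. c k * ((\<integral>\<omega>. g \<omega> * Y (\<tau> (Suc k)) \<omega> $ i \<partial>P) - (\<integral>\<omega>. g \<omega> * Y (\<tau> k) \<omega> $ i \<partial>P)))"
    using int in_L by (subst Bochner_Integration.integral_sum) auto
  also have "\<dots> = 0"
    using orth in_L by simp
  finally show ?thesis .
qed

section \<open>Covariances of Brownian motion\<close>

lemma sigma_sets_preimages_subset:
  assumes "f \<in> measurable M N"
  shows "sigma_sets (space M) {f -` A \<inter> space M |A. A \<in> sets N} \<subseteq> sets M"
  using assms by (intro sets.sigma_sets_subset) (auto intro: measurable_sets)

lemma borel_measurable_vec_nth: "(\<lambda>v :: real ^ 'n. v $ i) \<in> borel_measurable borel"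
  by (intro borel_measurable_continuous_onI continuous_intros)

context
  fixes P :: "'a measure" and B :: "real \<Rightarrow> 'a \<Rightarrow> real ^ 'n"
  assumes prob: "prob_space P" and bm: "standard_brownian_motion P B"
begin

interpretation prob_space P by (rule prob)

lemma brownian_measurable: "0 \<le> s \<Longrightarrow> B s \<in> borel_measurable P"
  using bm by (simp add: standard_brownian_motion_def)

lemma brownian_nth_measurable: "0 \<le> s \<Longrightarrow> (\<lambda>\<omega>. B s \<omega> $ i) \<in> borel_measurable P"
  using brownian_measurable by (intro measurable_compose[OF _ borel_measurable_vec_nth]) auto

lemma brownian_zero: "AE \<omega> in P. B 0 \<omega> = 0"
  using bm by (simp add: standard_brownian_motion_def)

lemma brownian_increment:
  assumes "0 \<le> s" "s < t"
  shows "L2 P (\<lambda>\<omega>. (B t \<omega> - B s \<omega>) $ i)"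
    and "(\<integral>\<omega>. (B t \<omega> - B s \<omega>) $ i \<partial>P) = 0"
    and "(\<integral>\<omega>. ((B t \<omega> - B s \<omega>) $ i)\<^sup>2 \<partial>P) = t - s"
proof -
  let ?X = "\<lambda>\<omega>. (B t \<omega> - B s \<omega>) $ i" and ?f = "normal_density 0 (sqrt (t - s))"
  have D: "distributed P lborel ?X ?f"
    using bm assms by (auto simp: standard_brownian_motion_def)
  have pos: "0 < sqrt (t - s)" using assms by simp
  have "integrable P (\<lambda>\<omega>. (?X \<omega>)\<^sup>2)"
    using distributed_integrable[OF D, of "\<lambda>x. x\<^sup>2"] integrable_normal_moment[OF pos, of 0 2] by simp
  then show "L2 P ?X"
    using distributed_measurable[OF D] by (simp add: L2_def)
  show "(\<integral>\<omega>. ?X \<omega> \<partial>P) = 0"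
    using distributed_integral[OF D, of "\<lambda>x. x"] integral_normal_moment_nz_1[OF pos, of 0] by simp
  show "(\<integral>\<omega>. (?X \<omega>)\<^sup>2 \<partial>P) = t - s"
    using distributed_integral[OF D, of "\<lambda>x. x\<^sup>2"] integral_normal_moment_even[OF pos, of 0 1] assms
    by (simp add: fact_numeral)
qed

text \<open>The definition prescribes laws for increments over s < t only, and \<open>B 0\<close>
  vanishes only almost surely. Hence the separate case s = 0 and the transfer from
  \<open>B s - B 0\<close> along almost everywhere equalities.\<close>

lemma brownian_nth:
  assumes "0 \<le> s"
  shows "L2 P (\<lambda>\<omega>. B s \<omega> $ i)" and "(\<integral>\<omega>. B s \<omega> $ i \<partial>P) = 0"
    and "(\<integral>\<omega>. (B s \<omega> $ i)\<^sup>2 \<partial>P) = s"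
proof -
  have m: "(\<lambda>\<omega>. B s \<omega> $ i) \<in> borel_measurable P"
    using assms by (rule brownian_nth_measurable)
  have "L2 P (\<lambda>\<omega>. B s \<omega> $ i) \<and> (\<integral>\<omega>. B s \<omega> $ i \<partial>P) = 0 \<and> (\<integral>\<omega>. (B s \<omega> $ i)\<^sup>2 \<partial>P) = s"
  proof (cases "s = 0")
    case True
    have z: "AE \<omega> in P. B s \<omega> $ i = 0" "AE \<omega> in P. (B s \<omega> $ i)\<^sup>2 = 0"
      using brownian_zero True by auto
    have "AE \<omega> in P. 0 = B s \<omega> $ i" using z(1) by eventually_elim simp
    then have "L2 P (\<lambda>\<omega>. B s \<omega> $ i)"
      by (rule L2_cong_AE[OF L2_zero m])
    with z show ?thesis
      using integral_eq_zero_AE[OF z(1)] integral_eq_zero_AE[OF z(2)] True by simp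
  next
    case False
    then have s: "0 < s" using assms by simp
    note inc = brownian_increment[OF order_refl s, of i]
    have e: "AE \<omega> in P. (B s \<omega> - B 0 \<omega>) $ i = B s \<omega> $ i"
      using brownian_zero by eventually_elim simp
    have "L2 P (\<lambda>\<omega>. B s \<omega> $ i)"
      by (rule L2_cong_AE[OF inc(1) m e])
    moreover have "(\<integral>\<omega>. B s \<omega> $ i \<partial>P) = (\<integral>\<omega>. (B s \<omega> - B 0 \<omega>) $ i \<partial>P)"
      using e m L2_measurable[OF inc(1)] by (intro integral_cong_AE) auto
    moreover have "(\<integral>\<omega>. (B s \<omega> $ i)\<^sup>2 \<partial>P) = (\<integral>\<omega>. ((B s \<omega> - B 0 \<omega>) $ i)\<^sup>2 \<partial>P)"
      using e m L2_measurable[OF inc(1)] by (intro integral_cong_AE) auto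
    ultimately show ?thesis using inc by simp
  qed
  then show "L2 P (\<lambda>\<omega>. B s \<omega> $ i)" "(\<integral>\<omega>. B s \<omega> $ i \<partial>P) = 0" "(\<integral>\<omega>. (B s \<omega> $ i)\<^sup>2 \<partial>P) = s"
    by auto
qed

lemma brownian_components_orthogonal:
  assumes "0 \<le> s" "i \<noteq> j"
  shows "(\<integral>\<omega>. B s \<omega> $ i * B s \<omega> $ j \<partial>P) = 0"
proof (cases "s = 0")
  case True
  have "AE \<omega> in P. B s \<omega> $ i * B s \<omega> $ j = 0"
    using brownian_zero True by auto
  then show ?thesis by (rule integral_eq_zero_AE)
next
  case False
  then have s: "0 < s" using assms by simp
  let ?X = "\<lambda>i \<omega>. (B s \<omega> - B 0 \<omega>) $ i"
  have "indep_vars (\<lambda>_. borel) ?X UNIV"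
    using bm s by (auto simp: standard_brownian_motion_def)
  then have "indep_vars (\<lambda>_. borel) ?X {i, j}"
    by (rule indep_vars_subset) auto
  then have "(\<integral>\<omega>. (\<Prod>l\<in>{i,j}. ?X l \<omega>) \<partial>P) = (\<Prod>l\<in>{i,j}. \<integral>\<omega>. ?X l \<omega> \<partial>P)"
    using brownian_increment(1)[OF order_refl s]
    by (intro indep_vars_lebesgue_integral L2_integrable) auto
  then have "(\<integral>\<omega>. ?X i \<omega> * ?X j \<omega> \<partial>P) = 0"
    using \<open>i \<noteq> j\<close> brownian_increment(2)[OF order_refl s] by simp
  moreover have "(\<integral>\<omega>. B s \<omega> $ i * B s \<omega> $ j \<partial>P) = (\<integral>\<omega>. ?X i \<omega> * ?X j \<omega> \<partial>P)"
  proof (rule integral_cong_AE)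
    show "AE \<omega> in P. B s \<omega> $ i * B s \<omega> $ j = ?X i \<omega> * ?X j \<omega>"
      using brownian_zero by eventually_elim simp
  qed (use brownian_nth_measurable[OF assms(1)] L2_measurable[OF brownian_increment(1)[OF order_refl s]] in auto)
  ultimately show ?thesis by simp
qed

lemma brownian_past_orthogonal:
  assumes "0 \<le> s" "s \<le> t"
  shows "(\<integral>\<omega>. B s \<omega> $ i * (B t \<omega> - B s \<omega>) $ j \<partial>P) = 0"
proof (cases "0 < s \<and> s < t")
  case False
  with assms consider "s = 0" | "s = t" by linarith
  then have "AE \<omega> in P. B s \<omega> $ i * (B t \<omega> - B s \<omega>) $ j = 0"
    using brownian_zero by cases auto
  then show ?thesis by (rule integral_eq_zero_AE)
next
  case True
  then have s: "0 < s" and st: "s < t" by auto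
  \<comment> \<open>The times 0, s, t produce two independent vector increments. Taking component i
    of the first and j of the second treats equal and distinct components at once.\<close>
  define \<tau> where "\<tau> k = (if k = 0 then 0 else if k = 1 then s else t)" for k :: nat
  let ?X = "\<lambda>k \<omega>. B (\<tau> (Suc k)) \<omega> - B (\<tau> k) \<omega>"
  let ?x = "\<lambda>k \<omega>. ?X k \<omega> $ (if k = 0 then i else j)"
  have "0 \<le> \<tau> 0 \<and> (\<forall>k<2. \<tau> k \<le> \<tau> (Suc k))"
    using s st by (auto simp: \<tau>_def)
  then have "indep_vars (\<lambda>_. borel) ?X {..<2}"
    using bm by (auto simp: standard_brownian_motion_def)
  then have ind: "indep_vars (\<lambda>_. borel) ?x {..<2}"
    by (rule indep_vars_compose2[where Y = "\<lambda>k v. v $ (if k = 0 then i else j)"])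
      (rule borel_measurable_vec_nth)
  have L: "L2 P (?x k)" if "k < 2" for k
    using that brownian_increment(1)[OF order_refl s, of i] brownian_increment(1)[OF assms(1) st, of j]
    by (auto simp: \<tau>_def less_2_cases_iff)
  have "(\<integral>\<omega>. (\<Prod>k<2. ?x k \<omega>) \<partial>P) = (\<Prod>k<2. \<integral>\<omega>. ?x k \<omega> \<partial>P)"
    using ind L by (intro indep_vars_lebesgue_integral L2_integrable) auto
  then have "(\<integral>\<omega>. (B s \<omega> - B 0 \<omega>) $ i * (B t \<omega> - B s \<omega>) $ j \<partial>P) = 0"
    using brownian_increment(2)[OF assms(1) st, of j]
    by (simp add: \<tau>_def numeral_2_eq_2)
  moreover have "(\<integral>\<omega>. B s \<omega> $ i * (B t \<omega> - B s \<omega>) $ j \<partial>P) =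
      (\<integral>\<omega>. (B s \<omega> - B 0 \<omega>) $ i * (B t \<omega> - B s \<omega>) $ j \<partial>P)"
  proof (rule integral_cong_AE)
    show "AE \<omega> in P. B s \<omega> $ i * (B t \<omega> - B s \<omega>) $ j = (B s \<omega> - B 0 \<omega>) $ i * (B t \<omega> - B s \<omega>) $ j"
      using brownian_zero by eventually_elim simp
  qed (use brownian_nth_measurable[OF assms(1)] L2_measurable[OF brownian_increment(1)[OF order_refl s]]
      L2_measurable[OF brownian_increment(1)[OF assms(1) st]] in auto)
  ultimately show ?thesis by simp
qed

lemma brownian_covariance:
  assumes "0 \<le> s" "0 \<le> r"
  shows "(\<integral>\<omega>. B s \<omega> $ i * B r \<omega> $ j \<partial>P) = (if i = j then min s r else 0)"
proof -
  have le: "(\<integral>\<omega>. B s \<omega> $ i * B r \<omega> $ j \<partial>P) = (if i = j then s else 0)"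
    if s: "0 \<le> s" and sr: "s \<le> r" for s r i j
  proof -
    have L: "L2 P (\<lambda>\<omega>. B s \<omega> $ i)" "L2 P (\<lambda>\<omega>. B s \<omega> $ j)" "L2 P (\<lambda>\<omega>. B r \<omega> $ j)"
      using s sr by (auto intro: brownian_nth)
    have "(\<integral>\<omega>. B s \<omega> $ i * B r \<omega> $ j \<partial>P) =
        (\<integral>\<omega>. B s \<omega> $ i * B s \<omega> $ j + B s \<omega> $ i * (B r \<omega> - B s \<omega>) $ j \<partial>P)"
      by (simp add: algebra_simps)
    also have "\<dots> = (\<integral>\<omega>. B s \<omega> $ i * B s \<omega> $ j \<partial>P) + (\<integral>\<omega>. B s \<omega> $ i * (B r \<omega> - B s \<omega>) $ j \<partial>P)"
      using L by (intro Bochner_Integration.integral_add L2_mult_integrable) (auto intro: L2_diff)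
    also have "\<dots> = (if i = j then s else 0)"
      using brownian_nth(3)[OF s, of j] brownian_components_orthogonal[OF s, of i j]
        brownian_past_orthogonal[OF s sr, of i j] by (cases "i = j") (simp_all add: power2_eq_square)
    finally show ?thesis .
  qed
  show ?thesis
    using le[of s r i j] le[of r s j i] assms by (cases "s \<le> r") (auto simp: mult.commute)
qed

text \<open>The case of a constant integrand 1: the covariance \<open>min s r\<close> is the
  Lebesgue measure of the intersection of \<open>{0<..s}\<close> and \<open>{0<..r}\<close>.\<close>

lemma brownian_orthogonal_increments:
  "orthogonal_increments P B L (lebesgue_on {0..L})"
proof -
  have fin: "finite_measure (lebesgue_on {0..L})"
    by (intro finite_measure_lebesgue_on) auto
  have ind: "L2 (lebesgue_on {0..L}) (indicator {0<..s})" for s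
  proof (rule L2_bounded[OF fin, of _ 1])
    show "indicat_real {0<..s} \<in> borel_measurable (lebesgue_on {0..L})"
      by (intro measurable_restrict_space1 measurable_completion) simp
  qed (auto simp: indicator_def)
  have "(\<integral>x. indicat_real {0<..s} x * indicat_real {0<..r} x \<partial>lebesgue_on {0..L}) = min s r"
    if "s \<in> {0..L}" "r \<in> {0..L}" for s r
  proof -
    have "(\<integral>x. indicat_real {0<..s} x * indicat_real {0<..r} x \<partial>lebesgue_on {0..L}) =
        (\<integral>x. indicat_real {0<..min s r} x \<partial>lebesgue_on {0..L})"
      by (intro Bochner_Integration.integral_cong) (auto simp: indicator_def)
    also have "\<dots> = measure (lebesgue_on {0..L}) ({0<..min s r} \<inter> {0..L})"
      by simp
    also have "{0<..min s r} \<inter> {0..L} = {0<..min s r}"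
      using that by auto
    also have "measure (lebesgue_on {0..L}) {0<..min s r} = min s r"
      using that by (subst measure_restrict_space) auto
    finally show ?thesis .
  qed
  then show ?thesis
    unfolding orthogonal_increments_def using ind brownian_nth(1) brownian_covariance by auto
qed

text \<open>Independence is assumed for the sigma-algebra of the whole path. A component of X and a
  coordinate of \<open>B s\<close> generate smaller sigma-algebras, so these two variables are
  independent, and the product of their means vanishes with the mean of \<open>B s\<close>.\<close>

lemma brownian_independent_orthogonal:
  assumes ind: "independent_of_process P X B" and Xm: "X \<in> borel_measurable P"
    and X: "L2 P (\<lambda>\<omega>. X \<omega> $ k)" and s: "0 \<le> s"
  shows "(\<integral>\<omega>. X \<omega> $ k * B s \<omega> $ i \<partial>P) = 0"
proof -
  let ?path = "\<lambda>\<omega>. \<lambda>t\<in>{0..}. B t \<omega>" and ?PM = "\<Pi>\<^sub>M t\<in>{0::real..}. (borel :: (real ^ 'n) measure)"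
  have path: "?path \<in> measurable P ?PM"
    using brownian_measurable by (intro measurable_restrict) auto
  let ?VX = "vimage_algebra (space P) X borel" and ?VB = "vimage_algebra (space P) ?path ?PM"
  have "(\<lambda>\<omega>. X \<omega> $ k) \<in> borel_measurable ?VX"
    by (intro measurable_compose[OF measurable_vimage_algebra1 borel_measurable_vec_nth]) simp
  then have 1: "sigma_sets (space P) {(\<lambda>\<omega>. X \<omega> $ k) -` A \<inter> space P |A. A \<in> sets borel} \<subseteq> sets ?VX"
    by (drule_tac sigma_sets_preimages_subset) simp
  have "(\<lambda>p. p s) \<in> borel_measurable ?PM"
    using s by (intro measurable_component_singleton) auto
  then have "(\<lambda>p. p s $ i) \<in> borel_measurable ?PM"
    by (rule measurable_compose[OF _ borel_measurable_vec_nth])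
  then have "(\<lambda>\<omega>. ?path \<omega> s $ i) \<in> borel_measurable ?VB"
    by (rule measurable_compose[rotated, of "\<lambda>p. p s $ i"])
      (intro measurable_vimage_algebra1 Pi_I measurable_space[OF path])
  then have "(\<lambda>\<omega>. B s \<omega> $ i) \<in> borel_measurable ?VB"
    using s by simp
  then have 2: "sigma_sets (space P) {(\<lambda>\<omega>. B s \<omega> $ i) -` A \<inter> space P |A. A \<in> sets borel} \<subseteq> sets ?VB"
    by (drule_tac sigma_sets_preimages_subset) simp
  have "indep_set (sigma_sets (space P) {(\<lambda>\<omega>. X \<omega> $ k) -` A \<inter> space P |A. A \<in> sets borel})
      (sigma_sets (space P) {(\<lambda>\<omega>. B s \<omega> $ i) -` A \<inter> space P |A. A \<in> sets borel})"
    unfolding indep_set_def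
  proof (rule indep_sets_mono_sets[OF ind[unfolded independent_of_process_def indep_set_def]])
    fix b :: bool
    show "(case b of
        True \<Rightarrow> sigma_sets (space P) {(\<lambda>\<omega>. X \<omega> $ k) -` A \<inter> space P |A. A \<in> sets borel}
      | False \<Rightarrow> sigma_sets (space P) {(\<lambda>\<omega>. B s \<omega> $ i) -` A \<inter> space P |A. A \<in> sets borel})
      \<subseteq> (case b of True \<Rightarrow> sets ?VX | False \<Rightarrow> sets ?VB)"
      using 1 2 by (cases b) simp_all
  qed
  then have "indep_var borel (\<lambda>\<omega>. X \<omega> $ k) borel (\<lambda>\<omega>. B s \<omega> $ i)"
    unfolding indep_var_eq using L2_measurable[OF X] brownian_nth_measurable[OF s] by blast
  then have "(\<integral>\<omega>. X \<omega> $ k * B s \<omega> $ i \<partial>P) = (\<integral>\<omega>. X \<omega> $ k \<partial>P) * (\<integral>\<omega>. B s \<omega> $ i \<partial>P)"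
    using X brownian_nth(1)[OF s]
    by (intro indep_var_lebesgue_integral L2_integrable) auto
  then show ?thesis using brownian_nth(2)[OF s] by simp
qed

end

section \<open>Covariances of Wiener integrals\<close>

lemma finite_measure_density_square:
  assumes "L2 M f"
  shows "finite_measure (density M (\<lambda>x. ennreal ((f x)\<^sup>2)))"
proof
  note [measurable] = L2_measurable[OF assms]
  have "emeasure (density M (\<lambda>x. ennreal ((f x)\<^sup>2))) (space M) = (\<integral>\<^sup>+x. ennreal ((f x)\<^sup>2) \<partial>M)"
    by (auto simp: emeasure_density intro!: nn_integral_cong)
  then show "emeasure (density M (\<lambda>x. ennreal ((f x)\<^sup>2))) (space (density M (\<lambda>x. ennreal ((f x)\<^sup>2)))) \<noteq> \<infinity>"
    by (simp add: L2_nn_integral[OF assms])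
qed

text \<open>Allows approximations on \<open>{0..s}\<close> to be extended by zero to
  \<open>{0..L}\<close>, so that integrals up to different times s live over one common
  measure.\<close>

lemma nn_integral_lebesgue_on_extend:
  fixes f g :: "real \<Rightarrow> real"
  assumes "s \<le> L" "\<And>x. x \<in> {0..s} \<Longrightarrow> 0 \<le> g x \<and> g x \<le> f x" "\<And>x. x \<notin> {0..s} \<Longrightarrow> g x = 0"
  shows "(\<integral>\<^sup>+x. ennreal (g x) \<partial>lebesgue_on {0..L}) \<le> (\<integral>\<^sup>+x. ennreal (f x) \<partial>lebesgue_on {0..s})"
proof -
  have "ennreal (g x) * indicator {0..L} x \<le> ennreal (f x) * indicator {0..s} x" for x
    using assms(1) assms(2,3)[of x] by (cases "x \<in> {0..s}") (auto simp: ennreal_leI)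
  then show ?thesis
    by (auto simp: nn_integral_restrict_space intro!: nn_integral_mono)
qed

lemma step_function_outside:
  assumes "is_partition s n \<tau>" "x \<notin> {0<..s}"
  shows "step_function n \<tau> c x = 0"
  unfolding step_function_def
proof (rule sum.neutral, safe)
  fix k assume "k < n"
  then have "0 \<le> \<tau> k" "\<tau> (Suc k) \<le> s"
    using partition_bounds[OF assms(1), of k] partition_bounds[OF assms(1), of "Suc k"] by auto
  then have "x \<notin> {\<tau> k<..\<tau> (Suc k)}" using assms(2) by auto
  then show "c k * indicator {\<tau> k<..\<tau> (Suc k)} x = 0" by simp
qed

context
  fixes P :: "'a measure" and B :: "real \<Rightarrow> 'a \<Rightarrow> real ^ 'n"
  assumes prob: "prob_space P" and bm: "standard_brownian_motion P B"
begin

text \<open>Unpacks the definition into the form the isometry uses: componentwise on the random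
  side, and on the deterministic side convergence to the truncated integrand over the fixed interval
  \<open>{0..L}\<close>. The truncation drops the point 0, where step functions with half-open cells
  vanish.\<close>

lemma wiener_integral_approx:
  assumes W: "has_wiener_integral P B f s X" and s: "0 \<le> s" "s \<le> L"
    and f: "f \<in> borel_measurable (lebesgue_on {0..L})"
  obtains n \<tau> c where
    "\<And>m. is_partition s (n m) (\<tau> m)"
    "\<And>i. L2_tendsto P (\<lambda>m \<omega>. step_integral B (n m) (\<tau> m) (c m) \<omega> $ i) (\<lambda>\<omega>. X \<omega> $ i)"
    "L2_tendsto (lebesgue_on {0..L}) (\<lambda>m. step_function (n m) (\<tau> m) (c m)) (\<lambda>x. f x * indicator {0<..s} x)"
proof -
  obtain n \<tau> c where p: "\<And>m. is_partition s (n m) (\<tau> m)"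
    and l1: "(\<lambda>m. \<integral>\<^sup>+r. ennreal ((f r - step_function (n m) (\<tau> m) (c m) r)\<^sup>2) \<partial>lebesgue_on {0..s}) \<longlonglongrightarrow> 0"
    and l2: "(\<lambda>m. \<integral>\<^sup>+\<omega>. ennreal ((norm (X \<omega> - step_integral B (n m) (\<tau> m) (c m) \<omega>))\<^sup>2) \<partial>P) \<longlonglongrightarrow> 0"
    using W unfolding has_wiener_integral_def by auto
  have "L2_tendsto P (\<lambda>m \<omega>. step_integral B (n m) (\<tau> m) (c m) \<omega> $ i) (\<lambda>\<omega>. X \<omega> $ i)" for i
    unfolding L2_tendsto_def
  proof (rule tendsto_sandwich[OF _ _ tendsto_const l2])
    have "(X \<omega> $ i - Z \<omega> $ i)\<^sup>2 \<le> (norm (X \<omega> - Z \<omega>))\<^sup>2" for \<omega> and Z :: "'a \<Rightarrow> real ^ 'n"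
      by (metis abs_ge_zero component_le_norm_cart power2_abs power_mono vector_minus_component)
    then show "\<forall>\<^sub>F m in sequentially. (\<integral>\<^sup>+\<omega>. ennreal ((X \<omega> $ i - step_integral B (n m) (\<tau> m) (c m) \<omega> $ i)\<^sup>2) \<partial>P)
        \<le> (\<integral>\<^sup>+\<omega>. ennreal ((norm (X \<omega> - step_integral B (n m) (\<tau> m) (c m) \<omega>))\<^sup>2) \<partial>P)"
      by (intro always_eventually allI nn_integral_mono ennreal_leI)
  qed simp
  moreover have "L2_tendsto (lebesgue_on {0..L}) (\<lambda>m. step_function (n m) (\<tau> m) (c m)) (\<lambda>x. f x * indicator {0<..s} x)"
    unfolding L2_tendsto_def
  proof (rule tendsto_sandwich[OF _ _ tendsto_const l1])
    show "\<forall>\<^sub>F m in sequentially.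
        (\<integral>\<^sup>+x. ennreal ((f x * indicator {0<..s} x - step_function (n m) (\<tau> m) (c m) x)\<^sup>2) \<partial>lebesgue_on {0..L})
        \<le> (\<integral>\<^sup>+x. ennreal ((f x - step_function (n m) (\<tau> m) (c m) x)\<^sup>2) \<partial>lebesgue_on {0..s})"
    proof (intro always_eventually allI nn_integral_lebesgue_on_extend[OF s(2)])
      fix m x
      show "0 \<le> (f x * indicator {0<..s} x - step_function (n m) (\<tau> m) (c m) x)\<^sup>2 \<and>
          (f x * indicator {0<..s} x - step_function (n m) (\<tau> m) (c m) x)\<^sup>2
          \<le> (f x - step_function (n m) (\<tau> m) (c m) x)\<^sup>2"
        using step_function_outside[OF p, of x m "c m"] by (cases "x \<in> {0<..s}") auto
      show "(f x * indicator {0<..s} x - step_function (n m) (\<tau> m) (c m) x)\<^sup>2 = 0" if "x \<notin> {0..s}"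
        using step_function_outside[OF p, of x m "c m"] that by auto
    qed
  qed simp
  ultimately show ?thesis using that p by blast
qed

lemma wiener_integral_L2:
  assumes W: "has_wiener_integral P B f s X" and s: "0 \<le> s"
  shows "L2 P (\<lambda>\<omega>. X \<omega> $ i)"
proof -
  have f: "f \<in> borel_measurable (lebesgue_on {0..s})" and X: "X \<in> borel_measurable P"
    using W by (auto simp: has_wiener_integral_def)
  obtain n \<tau> c where p: "\<And>m. is_partition s (n m) (\<tau> m)"
    and l: "\<And>i. L2_tendsto P (\<lambda>m \<omega>. step_integral B (n m) (\<tau> m) (c m) \<omega> $ i) (\<lambda>\<omega>. X \<omega> $ i)"
    by (rule wiener_integral_approx[OF W s order_refl f]) (rule that)
  show ?thesis
    using l
    by (rule L2_limit[rotated 2])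
      (rule L2_step_integral[OF brownian_orthogonal_increments[OF prob bm] p order_refl],
       rule measurable_compose[OF X borel_measurable_vec_nth])
qed

lemma wiener_integrand_L2:
  assumes W: "has_wiener_integral P B f s X"
  shows "L2 (lebesgue_on {0..s}) f"
proof -
  have f: "f \<in> borel_measurable (lebesgue_on {0..s})"
    using W by (auto simp: has_wiener_integral_def)
  obtain n \<tau> c where p: "\<And>m. is_partition s (n m) (\<tau> m)"
    and l: "(\<lambda>m. \<integral>\<^sup>+r. ennreal ((f r - step_function (n m) (\<tau> m) (c m) r)\<^sup>2) \<partial>lebesgue_on {0..s}) \<longlonglongrightarrow> 0"
    using W unfolding has_wiener_integral_def by auto
  show ?thesis
    using l unfolding L2_tendsto_def[symmetric]
    by (rule L2_limit[rotated 2])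
      (rule L2_step_function[OF brownian_orthogonal_increments[OF prob bm] p order_refl], rule f)
qed

lemma wiener_integral_orthogonal:
  assumes W: "has_wiener_integral P B f s X" and s: "0 \<le> s"
    and g: "L2 P g" and orth: "\<And>r. 0 \<le> r \<Longrightarrow> (\<integral>\<omega>. g \<omega> * B r \<omega> $ i \<partial>P) = 0"
  shows "(\<integral>\<omega>. g \<omega> * X \<omega> $ i \<partial>P) = 0"
proof -
  have f: "f \<in> borel_measurable (lebesgue_on {0..s})"
    using W by (auto simp: has_wiener_integral_def)
  obtain n \<tau> c where p: "\<And>m. is_partition s (n m) (\<tau> m)"
    and l: "\<And>i. L2_tendsto P (\<lambda>m \<omega>. step_integral B (n m) (\<tau> m) (c m) \<omega> $ i) (\<lambda>\<omega>. X \<omega> $ i)"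
    by (rule wiener_integral_approx[OF W s order_refl f]) (rule that)
  note BO = brownian_orthogonal_increments[OF prob bm, of s]
  have "(\<lambda>m. \<integral>\<omega>. g \<omega> * step_integral B (n m) (\<tau> m) (c m) \<omega> $ i \<partial>P) \<longlonglongrightarrow> (\<integral>\<omega>. g \<omega> * X \<omega> $ i \<partial>P)"
    by (rule L2_tendsto_inner[OF g g L2_tendsto_const _ wiener_integral_L2[OF W s] l])
      (rule L2_step_integral[OF BO p order_refl])
  moreover have "(\<integral>\<omega>. g \<omega> * step_integral B (n m) (\<tau> m) (c m) \<omega> $ i \<partial>P) = 0" for m
    by (rule step_integral_orthogonal[OF BO p order_refl g]) (simp add: orth)
  ultimately show ?thesis by (simp add: LIMSEQ_const_iff)
qed

text \<open>The integrals at times s and r come with unrelated approximating sequences, which is why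
  the isometry had to admit two partitions. In the limit f^2 is absorbed into the measure, so that X
  has the same structure as B and the results on step integrals apply to it again.\<close>

lemma wiener_integral_orthogonal_increments:
  assumes W: "\<And>s. s \<in> {0..L} \<Longrightarrow> has_wiener_integral P B f s (X s)" and L: "0 \<le> L"
  shows "orthogonal_increments P X L (density (lebesgue_on {0..L}) (\<lambda>x. ennreal ((f x)\<^sup>2)))"
proof -
  let ?l = "lebesgue_on {0..L}"
  let ?\<mu> = "density ?l (\<lambda>x. ennreal ((f x)\<^sup>2))"
  have f: "L2 ?l f" using wiener_integrand_L2[OF W[of L]] L by simp
  note fm[measurable] = L2_measurable[OF f]
  note BO = brownian_orthogonal_increments[OF prob bm, of L]
  have [measurable]: "indicat_real {0<..s} \<in> borel_measurable ?l" for s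
    by (intro measurable_restrict_space1 measurable_completion) simp
  note fin = finite_measure_density_square[OF f]
  have "L2 ?\<mu> (indicator {0<..s})" for s
    by (rule L2_bounded[OF fin, of _ 1]) (auto simp: indicator_def)
  moreover have "L2 P (\<lambda>\<omega>. X s \<omega> $ i)" if "s \<in> {0..L}" for s i
    using wiener_integral_L2[OF W] that by auto
  moreover have "(\<integral>\<omega>. X s \<omega> $ i * X r \<omega> $ j \<partial>P) =
      (if i = j then 1 else 0) * (\<integral>x. indicator {0<..s} x * indicator {0<..r} x \<partial>?\<mu>)"
    if s: "s \<in> {0..L}" and r: "r \<in> {0..L}" for s r i j
  proof -
    obtain n \<tau> c where p: "\<And>m. is_partition s (n m) (\<tau> m)"
      and X: "\<And>i. L2_tendsto P (\<lambda>m \<omega>. step_integral B (n m) (\<tau> m) (c m) \<omega> $ i) (\<lambda>\<omega>. X s \<omega> $ i)"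
      and g: "L2_tendsto ?l (\<lambda>m. step_function (n m) (\<tau> m) (c m)) (\<lambda>x. f x * indicator {0<..s} x)"
      by (rule wiener_integral_approx[OF W[OF s] _ _ fm]) (use s in auto)
    obtain n' \<tau>' c' where p': "\<And>m. is_partition r (n' m) (\<tau>' m)"
      and X': "\<And>i. L2_tendsto P (\<lambda>m \<omega>. step_integral B (n' m) (\<tau>' m) (c' m) \<omega> $ i) (\<lambda>\<omega>. X r \<omega> $ i)"
      and g': "L2_tendsto ?l (\<lambda>m. step_function (n' m) (\<tau>' m) (c' m)) (\<lambda>x. f x * indicator {0<..r} x)"
      by (rule wiener_integral_approx[OF W[OF r] _ _ fm]) (use r in auto)
    have le: "s \<le> L" "r \<le> L" using s r by auto
    have LX: "L2 P (\<lambda>\<omega>. X s \<omega> $ i)" "L2 P (\<lambda>\<omega>. X r \<omega> $ j)"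
      using wiener_integral_L2[OF W] s r by auto
    note LS = L2_step_function[OF BO p le(1)] L2_step_function[OF BO p' le(2)]
    have Lg: "L2 ?l (\<lambda>x. f x * indicator {0<..s} x)"
      using g by (rule L2_limit[rotated 2]) (rule LS, measurable)
    have Lg': "L2 ?l (\<lambda>x. f x * indicator {0<..r} x)"
      using g' by (rule L2_limit[rotated 2]) (rule LS, measurable)
    have "(\<lambda>m. \<integral>\<omega>. step_integral B (n m) (\<tau> m) (c m) \<omega> $ i * step_integral B (n' m) (\<tau>' m) (c' m) \<omega> $ j \<partial>P)
        \<longlonglongrightarrow> (\<integral>\<omega>. X s \<omega> $ i * X r \<omega> $ j \<partial>P)"
      by (rule L2_tendsto_inner[OF _ LX(1) X _ LX(2) X'])
        (rule L2_step_integral[OF BO p le(1)], rule L2_step_integral[OF BO p' le(2)])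
    moreover have "(\<lambda>m. (if i = j then 1 else 0) *
          (\<integral>x. step_function (n m) (\<tau> m) (c m) x * step_function (n' m) (\<tau>' m) (c' m) x \<partial>?l))
        \<longlonglongrightarrow> (if i = j then 1 else 0) * (\<integral>x. (f x * indicator {0<..s} x) * (f x * indicator {0<..r} x) \<partial>?l)"
      by (rule tendsto_mult[OF tendsto_const L2_tendsto_inner[OF _ Lg g _ Lg' g']]) (rule LS)+
    ultimately have "(\<integral>\<omega>. X s \<omega> $ i * X r \<omega> $ j \<partial>P) =
        (if i = j then 1 else 0) * (\<integral>x. (f x * indicator {0<..s} x) * (f x * indicator {0<..r} x) \<partial>?l)"
      using LIMSEQ_unique by (simp only: step_integral_isometry[OF BO p le(1) p' le(2)]) blast
    also have "(\<integral>x. (f x * indicator {0<..s} x) * (f x * indicator {0<..r} x) \<partial>?l) =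
        (\<integral>x. (f x)\<^sup>2 *\<^sub>R (indicator {0<..s} x * indicator {0<..r} x) \<partial>?l)"
      by (intro Bochner_Integration.integral_cong) (auto simp: power2_eq_square)
    also have "\<dots> = (\<integral>x. indicator {0<..s} x * indicator {0<..r} x \<partial>?\<mu>)"
      by (rule integral_density[symmetric]) auto
    finally show ?thesis .
  qed
  ultimately show ?thesis unfolding orthogonal_increments_def by blast
qed

end

section \<open>Limits of matrix-weighted sums of increments\<close>

lemma L2_tendsto_uniform:
  assumes fin: "finite_measure M"
    and unif: "\<And>e. e > 0 \<Longrightarrow> \<forall>\<^sub>F n in sequentially. \<forall>x. \<bar>g x - f n x\<bar> \<le> e"
  shows "L2_tendsto M f g"
  unfolding L2_tendsto_def
proof (rule tendsto_zero_ennreal)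
  fix e :: real assume e: "0 < e"
  define V where "V = measure M (space M)"
  \<comment> \<open>Chosen so that d^2 V = e V / (2 (V + 1)), which is below e; adding 1 keeps the
    denominator positive when V = 0.\<close>
  define d where "d = sqrt (e / (2 * (V + 1)))"
  have V: "V \<ge> 0" by (simp add: V_def)
  have d: "d > 0" using e V by (simp add: d_def)
  have "d\<^sup>2 * V < e"
  proof -
    have "d\<^sup>2 * V = e * (V / (2 * (V + 1)))" using e V by (simp add: d_def)
    also have "\<dots> < e * 1" using e V by (intro mult_strict_left_mono) (auto simp: divide_simps)
    finally show ?thesis by simp
  qed
  show "\<forall>\<^sub>F n in sequentially. (\<integral>\<^sup>+x. ennreal ((g x - f n x)\<^sup>2) \<partial>M) < ennreal e"
    using unif[OF d]
  proof eventually_elim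
    case (elim n)
    have "(g x - f n x)\<^sup>2 \<le> d\<^sup>2" for x
      using elim by (metis abs_ge_zero power2_abs power_mono)
    then have "(\<integral>\<^sup>+x. ennreal ((g x - f n x)\<^sup>2) \<partial>M) \<le> (\<integral>\<^sup>+x. ennreal (d\<^sup>2) \<partial>M)"
      by (intro nn_integral_mono ennreal_leI)
    also have "\<dots> = ennreal (d\<^sup>2 * V)"
      using V by (simp add: V_def finite_measure.emeasure_eq_measure[OF fin] ennreal_mult)
    also have "\<dots> < ennreal e"
      using \<open>d\<^sup>2 * V < e\<close> e by (intro ennreal_lessI)
    finally show ?case .
  qed
qed

lemma L2_diff_square:
  assumes f: "L2 M f" and g: "L2 M g"
  shows "(\<integral>x. (f x - g x)\<^sup>2 \<partial>M) = (\<integral>x. f x * f x \<partial>M) - 2 * (\<integral>x. f x * g x \<partial>M) + (\<integral>x. g x * g x \<partial>M)"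
proof -
  have "(\<integral>x. (f x - g x)\<^sup>2 \<partial>M) = (\<integral>x. f x * f x - 2 * (f x * g x) + g x * g x \<partial>M)"
    by (intro Bochner_Integration.integral_cong) (auto simp: power2_eq_square algebra_simps)
  then show ?thesis
    using L2_mult_integrable[OF f f] L2_mult_integrable[OF f g] L2_mult_integrable[OF g g] by simp
qed

lemma L2_tendsto_Cauchy:
  assumes f: "\<And>n. L2 M (f n)" "L2 M g" "L2_tendsto M f g" and e: "e > 0"
  shows "\<exists>N. \<forall>n\<ge>N. \<forall>m\<ge>N. (\<integral>x. (f m x - f n x)\<^sup>2 \<partial>M) \<le> e"
proof -
  have "(\<lambda>n. \<integral>x. (g x - f n x)\<^sup>2 \<partial>M) \<longlonglongrightarrow> 0"
    using f by (simp add: L2_tendsto_iff)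
  from order_tendstoD(2)[OF this, of "e / 4"] e
  obtain N where N: "\<And>n. n \<ge> N \<Longrightarrow> (\<integral>x. (g x - f n x)\<^sup>2 \<partial>M) < e / 4"
    by (auto simp: eventually_sequentially)
  have "(\<integral>x. (f m x - f n x)\<^sup>2 \<partial>M) \<le> e" if "n \<ge> N" "m \<ge> N" for n m
  proof -
    have int: "integrable M (\<lambda>x. (g x - f n x)\<^sup>2)" for n
      using L2_diff[OF f(2) f(1)] by (simp add: L2_def)
    \<comment> \<open>The difference of the two sides is (2 c - a - b)^2. The two factors 2 account
      for the threshold e / 4 above.\<close>
    have "(a - b)\<^sup>2 \<le> 2 * (c - a)\<^sup>2 + 2 * (c - b)\<^sup>2" for a b c :: real
      using zero_le_power2[of "2 * c - a - b"] by (simp add: power2_eq_square algebra_simps)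
    then have "(\<integral>x. (f m x - f n x)\<^sup>2 \<partial>M) \<le> (\<integral>x. 2 * (g x - f m x)\<^sup>2 + 2 * (g x - f n x)\<^sup>2 \<partial>M)"
      using L2_diff[OF f(1) f(1), of m n] int[of m] int[of n] by (intro integral_mono) (auto simp: L2_def)
    also have "\<dots> = 2 * (\<integral>x. (g x - f m x)\<^sup>2 \<partial>M) + 2 * (\<integral>x. (g x - f n x)\<^sup>2 \<partial>M)"
      using int by simp
    also have "\<dots> \<le> e" using N[OF that(1)] N[OF that(2)] by simp
    finally show ?thesis .
  qed
  then show ?thesis by blast
qed

section \<open>Step approximation of continuous weights on uniform grids\<close>

lemma step_function_eq:
  assumes p: "is_partition s n \<tau>" and k: "k < n" and x: "x \<in> {\<tau> k<..\<tau> (Suc k)}"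
  shows "step_function n \<tau> c x = c k"
proof -
  have "x \<notin> {\<tau> j<..\<tau> (Suc j)}" if "j < n" "j \<noteq> k" for j
    using partition_mono[OF p, of "Suc j" k] partition_mono[OF p, of "Suc k" j] that k x
    by (cases "j < k") auto
  then have "step_function n \<tau> c x = (\<Sum>j<n. if j = k then c k else 0)"
    unfolding step_function_def using x by (intro sum.cong) auto
  then show ?thesis using k by simp
qed

lemma partition_cell:
  assumes "is_partition s n \<tau>" "x \<in> {0<..s}"
  obtains k where "k < n" "x \<in> {\<tau> k<..\<tau> (Suc k)}"
proof -
  \<comment> \<open>The first grid point not below x has positive index, since \<tau> starts at 0
    and x > 0; the cell ends there.\<close>
  have "\<exists>k<n. (\<forall>i\<le>k. \<not> x \<le> \<tau> i) \<and> x \<le> \<tau> (Suc k)"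
    using assms by (intro ex_least_nat_less) (auto simp: is_partition_def)
  then show ?thesis using that by (auto simp: not_le)
qed

text \<open>Index N stands for \<open>Suc N\<close> cells, so the mesh \<open>L / Suc N\<close>
  makes sense for every N.\<close>

definition uniform_grid :: "real \<Rightarrow> nat \<Rightarrow> nat \<Rightarrow> real" where
  "uniform_grid L N k = L * real k / real (Suc N)"

lemma is_partition_uniform_grid: "0 \<le> L \<Longrightarrow> is_partition L (Suc N) (uniform_grid L N)"
  by (auto simp: is_partition_def uniform_grid_def divide_right_mono mult_left_mono simp del: of_nat_Suc)

lemma uniform_grid_in: "0 \<le> L \<Longrightarrow> k \<le> Suc N \<Longrightarrow> uniform_grid L N k \<in> {0..L}"
  using partition_bounds[OF is_partition_uniform_grid] by auto

lemma uniform_grid_width: "uniform_grid L N (Suc k) - uniform_grid L N k = L / real (Suc N)"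
  by (simp add: uniform_grid_def diff_divide_distrib[symmetric] right_diff_distrib[symmetric] del: of_nat_Suc)

lemma eventually_uniform_grid_width:
  assumes "d > 0"
  shows "\<forall>\<^sub>F N in sequentially. L / real (Suc N) < d"
  using order_tendstoD(2)[OF LIMSEQ_Suc[OF lim_const_over_n[of L]] assms] by simp

text \<open>Values are taken at right endpoints, to match the sums that summation by parts produces.
  Both functions vanish off \<open>{0<..L}\<close>, so uniform continuity gives a bound at every
  real x, ready for any finite measure.\<close>

lemma step_function_uniform_approx:
  fixes m :: "real \<Rightarrow> real"
  assumes m: "continuous_on {0..L} m" and L: "0 \<le> L" and e: "e > 0"
  shows "\<forall>\<^sub>F N in sequentially. \<forall>x. \<bar>m x * indicator {0<..L} x
    - step_function (Suc N) (uniform_grid L N) (\<lambda>k. m (uniform_grid L N (Suc k))) x\<bar> \<le> e"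
proof -
  have "uniformly_continuous_on {0..L} m"
    using m by (intro compact_uniformly_continuous) auto
  then obtain d where d: "d > 0"
    and md: "\<And>x y. x \<in> {0..L} \<Longrightarrow> y \<in> {0..L} \<Longrightarrow> dist y x < d \<Longrightarrow> dist (m y) (m x) < e"
    using e unfolding uniformly_continuous_on_def by metis
  show ?thesis
    using eventually_uniform_grid_width[OF d, of L]
  proof (eventually_elim, intro allI)
    fix N x assume N: "L / real (Suc N) < d"
    let ?\<tau> = "uniform_grid L N"
    note p = is_partition_uniform_grid[OF L, of N]
    show "\<bar>m x * indicator {0<..L} x - step_function (Suc N) ?\<tau> (\<lambda>k. m (?\<tau> (Suc k))) x\<bar> \<le> e"
    proof (cases "x \<in> {0<..L}")
      case False
      then show ?thesis using step_function_outside[OF p False] e by simp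
    next
      case True
      obtain k where k: "k < Suc N" "x \<in> {?\<tau> k<..?\<tau> (Suc k)}"
        using partition_cell[OF p True] by blast
      have "dist (m x) (m (?\<tau> (Suc k))) < e"
      proof (rule md)
        show "?\<tau> (Suc k) \<in> {0..L}" using uniform_grid_in[OF L, of "Suc k" N] k by simp
        show "dist x (?\<tau> (Suc k)) < d" using uniform_grid_width[of L N k] N k(2) by (auto simp: dist_real_def)
      qed (use True in auto)
      then show ?thesis using step_function_eq[OF p k] True by (simp add: dist_real_def)
    qed
  qed
qed

text \<open>To be used with Y = X, \<mu> the measure with density sigma^2, m = M(L, .) and Z =
  psi(L) - M(L, 0) psi(0). Only almost sure convergence of the sums is assumed; mean square
  convergence is derived.\<close>

locale matrix_wiener_limit =
  fixes P :: "'a measure" and Y :: "real \<Rightarrow> 'a \<Rightarrow> real ^ 'n" and L :: real and \<mu> :: "real measure"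
    and m :: "real \<Rightarrow> real ^ 'n ^ 'n" and Z :: "'a \<Rightarrow> real ^ 'n"
  assumes Y: "orthogonal_increments P Y L \<mu>" and L: "0 \<le> L" and fin: "finite_measure \<mu>"
    and m: "continuous_on {0..L} m" and Z: "Z \<in> borel_measurable P"
    and lim: "AE \<omega> in P. (\<lambda>N. \<Sum>k<Suc N. m (uniform_grid L N (Suc k)) *v
      (Y (uniform_grid L N (Suc k)) \<omega> - Y (uniform_grid L N k) \<omega>)) \<longlonglongrightarrow> Z \<omega>"
begin

definition matrix_step :: "nat \<Rightarrow> 'n \<Rightarrow> 'n \<Rightarrow> real \<Rightarrow> real" where
  "matrix_step N i p = step_function (Suc N) (uniform_grid L N) (\<lambda>k. m (uniform_grid L N (Suc k)) $ i $ p)"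

text \<open>Splitting by matrix entries reduces the vector sum to scalar step integrals. Terms
  driven by distinct noise components p and q are orthogonal, so inner products of the full sums
  become sums over p alone.\<close>

definition step_term :: "nat \<Rightarrow> 'n \<Rightarrow> 'n \<Rightarrow> 'a \<Rightarrow> real" where
  "step_term N i p \<omega> =
     step_integral Y (Suc N) (uniform_grid L N) (\<lambda>k. m (uniform_grid L N (Suc k)) $ i $ p) \<omega> $ p"

definition matrix_integrand :: "'n \<Rightarrow> 'n \<Rightarrow> real \<Rightarrow> real" where
  "matrix_integrand i p x = m x $ i $ p * indicator {0<..L} x"

lemma L2_matrix_step: "L2 \<mu> (matrix_step N i p)"
  unfolding matrix_step_def by (rule L2_step_function[OF Y is_partition_uniform_grid[OF L] order_refl])

lemma L2_step_term: "L2 P (step_term N i p)"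
  unfolding step_term_def[abs_def] by (rule L2_step_integral[OF Y is_partition_uniform_grid[OF L] order_refl])

lemma step_term_inner:
  "(\<integral>\<omega>. step_term N i p \<omega> * step_term M j q \<omega> \<partial>P) =
    (if p = q then (\<integral>x. matrix_step N i p x * matrix_step M j q x \<partial>\<mu>) else 0)"
  unfolding step_term_def matrix_step_def
  by (subst step_integral_isometry[OF Y is_partition_uniform_grid[OF L] order_refl is_partition_uniform_grid[OF L] order_refl]) simp

lemma matrix_step_uniform:
  "e > 0 \<Longrightarrow> \<forall>\<^sub>F N in sequentially. \<forall>x. \<bar>matrix_integrand i p x - matrix_step N i p x\<bar> \<le> e"
  unfolding matrix_integrand_def matrix_step_def
  by (rule step_function_uniform_approx[OF _ L]) (intro continuous_intros m)

lemma matrix_step_tendsto: "L2_tendsto \<mu> (\<lambda>N. matrix_step N i p) (matrix_integrand i p)"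
  by (rule L2_tendsto_uniform[OF fin matrix_step_uniform])

text \<open>The sigma-algebra of \<mu> is known only through the indicators of
  \<open>{0<..s}\<close>, so continuity of m does not give measurability directly; it is obtained
  from the pointwise limit of the step functions.\<close>

lemma L2_matrix_integrand: "L2 \<mu> (matrix_integrand i p)"
proof (rule L2_limit[OF L2_matrix_step _ matrix_step_tendsto])
  show "matrix_integrand i p \<in> borel_measurable \<mu>"
  proof (rule borel_measurable_LIMSEQ_metric)
    show "matrix_step N i p \<in> borel_measurable \<mu>" for N
      by (rule L2_measurable[OF L2_matrix_step])
    show "(\<lambda>N. matrix_step N i p x) \<longlonglongrightarrow> matrix_integrand i p x" for x
    proof (rule tendstoI)
      fix e :: real assume e: "e > 0"
      then have "\<forall>\<^sub>F N in sequentially. \<forall>x. \<bar>matrix_integrand i p x - matrix_step N i p x\<bar> \<le> e / 2"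
        by (intro matrix_step_uniform) simp
      then show "\<forall>\<^sub>F N in sequentially. dist (matrix_step N i p x) (matrix_integrand i p x) < e"
      proof eventually_elim
        case (elim N)
        from spec[OF this, of x] e show ?case by (simp add: dist_real_def abs_minus_commute)
      qed
    qed
  qed
qed

definition step_sum :: "nat \<Rightarrow> 'n \<Rightarrow> 'a \<Rightarrow> real" where
  "step_sum N i \<omega> = (\<Sum>p\<in>UNIV. step_term N i p \<omega>)"

lemma L2_step_sum: "L2 P (step_sum N i)"
  unfolding step_sum_def[abs_def] by (intro L2_sum L2_step_term)

lemma step_sum_inner:
  "(\<integral>\<omega>. step_sum N i \<omega> * step_sum M j \<omega> \<partial>P) = (\<Sum>p\<in>UNIV. \<integral>x. matrix_step N i p x * matrix_step M j p x \<partial>\<mu>)"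
  using L2_inner_sum[of UNIV P "step_term N i" UNIV "step_term M j" "\<lambda>_. 1" "\<lambda>_. 1", OF L2_step_term L2_step_term]
  by (simp add: step_sum_def step_term_inner)

lemma step_sum_lim: "AE \<omega> in P. (\<lambda>N. step_sum N i \<omega>) \<longlonglongrightarrow> Z \<omega> $ i"
  using lim
proof eventually_elim
  case (elim \<omega>)
  have "(\<Sum>k<Suc N. m (uniform_grid L N (Suc k)) *v (Y (uniform_grid L N (Suc k)) \<omega> - Y (uniform_grid L N k) \<omega>)) $ i
      = step_sum N i \<omega>" for N
    unfolding step_sum_def step_term_def step_integral_nth sum_component
    by (subst sum.swap) (simp only: matrix_vector_mult_def vec_lambda_beta vector_minus_component)
  with tendsto_vec_nth[OF elim, of i] show ?case by simp
qed

text \<open>The isometry transports the Cauchy property of the deterministic step functions to the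
  random sums, and the almost sure limit then identifies the mean square limit.\<close>

lemma step_sum_tendsto: "L2_tendsto P (\<lambda>N. step_sum N i) (\<lambda>\<omega>. Z \<omega> $ i)"
proof (rule L2_Fatou[OF L2_step_sum measurable_compose[OF Z borel_measurable_vec_nth] step_sum_lim])
  fix e :: real assume e: "e > 0"
  have diff: "(\<integral>\<omega>. (step_sum M i \<omega> - step_sum N i \<omega>)\<^sup>2 \<partial>P) =
      (\<Sum>p\<in>UNIV. \<integral>x. (matrix_step M i p x - matrix_step N i p x)\<^sup>2 \<partial>\<mu>)" for M N
  proof -
    show ?thesis
      by (simp add: L2_diff_square[OF L2_step_sum L2_step_sum] L2_diff_square[OF L2_matrix_step L2_matrix_step]
          step_sum_inner sum.distrib sum_subtractf sum_distrib_left)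
  qed
  \<comment> \<open>The isometry produces one term for each of the \<open>CARD('n)\<close> noise
    components, so each receives an equal share of e.\<close>
  have "\<forall>p. \<exists>N. \<forall>n\<ge>N. \<forall>k\<ge>N. (\<integral>x. (matrix_step k i p x - matrix_step n i p x)\<^sup>2 \<partial>\<mu>) \<le> e / CARD('n)"
    using e by (intro allI L2_tendsto_Cauchy[OF L2_matrix_step L2_matrix_integrand matrix_step_tendsto]) simp
  then obtain N where N: "\<And>p n k. n \<ge> N p \<Longrightarrow> k \<ge> N p \<Longrightarrow>
      (\<integral>x. (matrix_step k i p x - matrix_step n i p x)\<^sup>2 \<partial>\<mu>) \<le> e / CARD('n)"
    by metis
  have "(\<integral>\<omega>. (step_sum k i \<omega> - step_sum n i \<omega>)\<^sup>2 \<partial>P) \<le> e"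
    if "n \<ge> Max (range N)" "k \<ge> Max (range N)" for n k
  proof -
    have "(\<integral>\<omega>. (step_sum k i \<omega> - step_sum n i \<omega>)\<^sup>2 \<partial>P) \<le> (\<Sum>p\<in>(UNIV :: 'n set). e / CARD('n))"
      unfolding diff using that by (intro sum_mono N) auto
    then show ?thesis by simp
  qed
  then show "\<exists>N. \<forall>n\<ge>N. \<forall>k\<ge>N. (\<integral>\<omega>. (step_sum k i \<omega> - step_sum n i \<omega>)\<^sup>2 \<partial>P) \<le> e"
    by blast
qed

lemma matrix_integral_L2: "L2 P (\<lambda>\<omega>. Z \<omega> $ i)"
  by (rule L2_limit[OF L2_step_sum measurable_compose[OF Z borel_measurable_vec_nth] step_sum_tendsto])

lemma matrix_integral_covariance:
  "(\<integral>\<omega>. Z \<omega> $ i * Z \<omega> $ j \<partial>P) =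
    (\<Sum>p\<in>UNIV. \<integral>x. (m x $ i $ p * indicator {0<..L} x) * (m x $ j $ p * indicator {0<..L} x) \<partial>\<mu>)"
proof -
  have "(\<lambda>N. \<integral>\<omega>. step_sum N i \<omega> * step_sum N j \<omega> \<partial>P) \<longlonglongrightarrow> (\<integral>\<omega>. Z \<omega> $ i * Z \<omega> $ j \<partial>P)"
    by (rule L2_tendsto_inner[OF L2_step_sum matrix_integral_L2 step_sum_tendsto
          L2_step_sum matrix_integral_L2 step_sum_tendsto])
  moreover have "(\<lambda>N. \<integral>\<omega>. step_sum N i \<omega> * step_sum N j \<omega> \<partial>P) \<longlonglongrightarrow>
      (\<Sum>p\<in>UNIV. \<integral>x. matrix_integrand i p x * matrix_integrand j p x \<partial>\<mu>)"
    unfolding step_sum_inner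
    by (rule tendsto_sum) (rule L2_tendsto_inner[OF L2_matrix_step L2_matrix_integrand matrix_step_tendsto
          L2_matrix_step L2_matrix_integrand matrix_step_tendsto])
  ultimately show ?thesis
    using LIMSEQ_unique unfolding matrix_integrand_def by blast
qed

lemma matrix_integral_orthogonal:
  assumes g: "L2 P g" and orth: "\<And>s i. s \<in> {0..L} \<Longrightarrow> (\<integral>\<omega>. g \<omega> * Y s \<omega> $ i \<partial>P) = 0"
  shows "(\<integral>\<omega>. g \<omega> * Z \<omega> $ i \<partial>P) = 0"
proof -
  have "(\<lambda>N. \<integral>\<omega>. g \<omega> * step_sum N i \<omega> \<partial>P) \<longlonglongrightarrow> (\<integral>\<omega>. g \<omega> * Z \<omega> $ i \<partial>P)"
    by (rule L2_tendsto_inner[OF g g L2_tendsto_const L2_step_sum matrix_integral_L2 step_sum_tendsto])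
  moreover have "(\<integral>\<omega>. g \<omega> * step_sum N i \<omega> \<partial>P) = 0" for N
  proof -
    have "(\<integral>\<omega>. g \<omega> * step_term N i p \<omega> \<partial>P) = 0" for p
      unfolding step_term_def
      by (rule step_integral_orthogonal[OF Y is_partition_uniform_grid[OF L] order_refl g orth])
    then show ?thesis
      using L2_mult_integrable[OF g L2_step_term]
      by (simp add: step_sum_def sum_distrib_left Bochner_Integration.integral_sum)
  qed
  ultimately show ?thesis by (simp add: LIMSEQ_const_iff)
qed

end

section \<open>The fundamental matrix\<close>

lemma bounded_bilinear_matrix_matrix_mult:
  "bounded_bilinear ((**) :: real ^ 'n ^ 'm \<Rightarrow> real ^ 'p ^ 'n \<Rightarrow> real ^ 'p ^ 'm)"
  unfolding bilinear_conv_bounded_bilinear[symmetric] bilinear_def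
  by (intro conjI allI linearI)
    (simp_all add: vec_eq_iff matrix_matrix_mult_def algebra_simps sum.distrib sum_distrib_left)

lemma bounded_bilinear_matrix_vector_mult:
  "bounded_bilinear ((*v) :: real ^ 'n ^ 'm \<Rightarrow> real ^ 'n \<Rightarrow> real ^ 'm)"
  unfolding bilinear_conv_bounded_bilinear[symmetric] bilinear_def
  by (intro conjI allI linearI)
    (simp_all add: vec_eq_iff matrix_vector_mult_def algebra_simps sum.distrib sum_distrib_left)

lemmas has_vector_derivative_matrix_mult =
  bounded_bilinear.has_vector_derivative[OF bounded_bilinear_matrix_matrix_mult]

lemmas has_vector_derivative_matrix_vector_mult =
  bounded_bilinear.has_vector_derivative[OF bounded_bilinear_matrix_vector_mult]

lemmas continuous_on_matrix_mult = bounded_bilinear.continuous_on[OF bounded_bilinear_matrix_matrix_mult]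

lemmas continuous_on_matrix_vector_mult = bounded_bilinear.continuous_on[OF bounded_bilinear_matrix_vector_mult]

text \<open>In this form the difference quotient of an inverse can be rewritten algebraically
  through the quotient of the original function.\<close>

lemma has_vector_derivative_iff_quotient:
  "(f has_vector_derivative D) (at x within S) \<longleftrightarrow> ((\<lambda>y. (f y - f x) /\<^sub>R (y - x)) \<longlongrightarrow> D) (at x within S)"
proof -
  have eq: "norm ((f y - f x) - (y - x) *\<^sub>R D) / norm (y - x) = norm ((f y - f x) /\<^sub>R (y - x) - D)"
    if "y \<noteq> x" for y
  proof -
    have "(f y - f x) - (y - x) *\<^sub>R D = (y - x) *\<^sub>R ((f y - f x) /\<^sub>R (y - x) - D)"
      using that by (simp add: scaleR_diff_right)
    then show ?thesis using that by simp
  qed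
  have "(f has_vector_derivative D) (at x within S) \<longleftrightarrow>
      ((\<lambda>y. norm ((f y - f x) - (y - x) *\<^sub>R D) / norm (y - x)) \<longlongrightarrow> 0) (at x within S)"
    by (simp add: has_vector_derivative_def has_derivative_iff_norm bounded_linear_scaleR_left)
  also have "\<dots> \<longleftrightarrow> ((\<lambda>y. norm ((f y - f x) /\<^sub>R (y - x) - D)) \<longlongrightarrow> 0) (at x within S)"
    using eq by (intro filterlim_cong refl) (auto simp: eventually_at intro!: exI[of _ 1])
  finally show ?thesis
    by (simp add: tendsto_norm_zero_iff LIM_zero_iff)
qed

text \<open>Gronwall by an energy function: the derivative of |X|^2 is at most 2 C K |X|^2, where C
  bounds A and K is the constant of the matrix product for the norm in use. Hence exp(- 2 C K s)
  |X(s)|^2 cannot exceed its initial value 0.\<close>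

lemma linear_ode_unique_zero:
  fixes X A :: "real \<Rightarrow> real ^ 'n ^ 'n"
  assumes A: "continuous_on {0..L} A"
    and X: "\<And>s. s \<in> {0..L} \<Longrightarrow> (X has_vector_derivative A s ** X s) (at s within {0..L})"
    and X0: "X 0 = 0" and s: "s \<in> {0..L}"
  shows "X s = 0"
proof -
  obtain K where K: "K > 0" "\<And>(a :: real ^ 'n ^ 'n) (b :: real ^ 'n ^ 'n). norm (a ** b) \<le> norm a * norm b * K"
    using bounded_bilinear.pos_bounded[OF bounded_bilinear_matrix_matrix_mult] by blast
  obtain C where C: "\<And>s. s \<in> {0..L} \<Longrightarrow> norm (A s) \<le> C"
    using compact_imp_bounded[OF compact_continuous_image[OF A compact_Icc]]
    unfolding bounded_iff by blast
  define g where "g s = exp (- 2 * (C * K) * s) * (X s \<bullet> X s)" for s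
  have dg: "(g has_vector_derivative exp (- 2 * (C * K) * s) * (2 * (X s \<bullet> (A s ** X s)) - 2 * (C * K) * (X s \<bullet> X s)))
      (at s within {0..L})" if "s \<in> {0..L}" for s
  proof -
    have 1: "((\<lambda>s. X s \<bullet> X s) has_vector_derivative X s \<bullet> (A s ** X s) + (A s ** X s) \<bullet> X s) (at s within {0..L})"
      by (rule bounded_bilinear.has_vector_derivative[OF bounded_bilinear_inner X[OF that] X[OF that]])
    have 2: "((\<lambda>s. exp (- 2 * (C * K) * s)) has_vector_derivative exp (- 2 * (C * K) * s) * (- 2 * (C * K))) (at s within {0..L})"
      unfolding has_real_derivative_iff_has_vector_derivative[symmetric]
      by (auto intro!: derivative_eq_intros)
    from has_vector_derivative_mult[OF 2 1] show ?thesis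
      unfolding g_def by (rule has_vector_derivative_eq_rhs) (simp add: inner_commute algebra_simps)
  qed
  have "g s \<le> g 0"
  proof -
    have "\<exists>x\<in>{0..s}. g s - g 0 = (\<lambda>h. h *\<^sub>R (exp (- 2 * (C * K) * x) *
        (2 * (X x \<bullet> (A x ** X x)) - 2 * (C * K) * (X x \<bullet> X x)))) (s - 0)"
    proof (rule mvt_very_simple)
      fix x assume x: "0 \<le> x" "x \<le> s"
      then have "x \<in> {0..L}" "{0..s} \<subseteq> {0..L}" using s by auto
      then show "(g has_derivative (\<lambda>h. h *\<^sub>R (exp (- 2 * (C * K) * x) *
          (2 * (X x \<bullet> (A x ** X x)) - 2 * (C * K) * (X x \<bullet> X x))))) (at x within {0..s})"
        using has_derivative_subset[OF dg[unfolded has_vector_derivative_def]] by blast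
    qed (use s in auto)
    then obtain x where x: "x \<in> {0..s}" and eq: "g s - g 0 = s * (exp (- 2 * (C * K) * x) *
        (2 * (X x \<bullet> (A x ** X x)) - 2 * (C * K) * (X x \<bullet> X x)))" by auto
    have "X x \<bullet> (A x ** X x) \<le> norm (X x) * (norm (A x) * norm (X x) * K)"
      using norm_cauchy_schwarz[of "X x" "A x ** X x"] K(2)[of "A x" "X x"]
      by (meson mult_left_mono norm_ge_zero order_trans)
    also have "\<dots> \<le> norm (X x) * (C * norm (X x) * K)"
      using C[of x] x s K(1) by (intro mult_left_mono mult_right_mono) auto
    also have "\<dots> = (C * K) * (X x \<bullet> X x)"
      by (simp add: dot_square_norm power2_eq_square)
    finally have "exp (- 2 * (C * K) * x) * (2 * (X x \<bullet> (A x ** X x)) - 2 * (C * K) * (X x \<bullet> X x)) \<le> 0"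
      by (intro mult_nonneg_nonpos) auto
    then have "s * (exp (- 2 * (C * K) * x) * (2 * (X x \<bullet> (A x ** X x)) - 2 * (C * K) * (X x \<bullet> X x))) \<le> 0"
      using s by (intro mult_nonneg_nonpos[of s]) (auto simp only: atLeastAtMost_iff)
    then have "g s - g 0 \<le> 0" unfolding eq .
    then show ?thesis by simp
  qed
  then have "exp (- 2 * (C * K) * s) * (X s \<bullet> X s) \<le> 0"
    using X0 by (simp add: g_def)
  then have "X s \<bullet> X s \<le> 0" by (simp add: mult_le_0_iff)
  then show ?thesis using inner_ge_zero[of "X s"] inner_eq_zero_iff[of "X s"] by linarith
qed

section \<open>Cocycle identity and derivative in the second argument\<close>

context
  fixes A :: "real \<Rightarrow> real ^ 'n ^ 'n" and M :: "real \<Rightarrow> real \<Rightarrow> real ^ 'n ^ 'n" and L :: real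
  assumes A: "continuous_on {0..L} A" and M: "fundamental_matrix A {0..L} M" and L: "0 \<le> L"
begin

lemma fundamental_matrix_deriv:
  "u \<in> {0..L} \<Longrightarrow> s \<in> {0..L} \<Longrightarrow> ((\<lambda>r. M r u) has_vector_derivative A s ** M s u) (at s within {0..L})"
  using M by (simp add: fundamental_matrix_def)

lemma fundamental_matrix_diag: "u \<in> {0..L} \<Longrightarrow> M u u = mat 1"
  using M by (simp add: fundamental_matrix_def)

text \<open>As functions of r both sides solve the same linear equation and agree at r = 0, so
  uniqueness applies to their difference. For r = u it exhibits \<open>M 0 u\<close> as the inverse
  of \<open>M u 0\<close>.\<close>

lemma fundamental_matrix_factor:
  assumes "r \<in> {0..L}" "u \<in> {0..L}"
  shows "M r u = M r 0 ** M 0 u"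
proof -
  have 0: "0 \<in> {0..L}" using L by simp
  have "((\<lambda>r. M r u - M r 0 ** M 0 u) has_vector_derivative A s ** (M s u - M s 0 ** M 0 u)) (at s within {0..L})"
    if "s \<in> {0..L}" for s
    using has_vector_derivative_diff[OF fundamental_matrix_deriv[OF assms(2) that]
        has_vector_derivative_matrix_mult[OF fundamental_matrix_deriv[OF 0 that] has_vector_derivative_const[of "M 0 u"]]]
    by (rule has_vector_derivative_eq_rhs)
      (simp add: bounded_bilinear.diff_right[OF bounded_bilinear_matrix_matrix_mult] matrix_mul_assoc)
  from linear_ode_unique_zero[OF A this _ assms(1)] show ?thesis
    using fundamental_matrix_diag[OF 0] by simp
qed

lemma fundamental_matrix_inverse:
  assumes "u \<in> {0..L}"
  shows "M u 0 ** M 0 u = mat 1" "M 0 u ** M u 0 = mat 1"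
proof -
  show "M u 0 ** M 0 u = mat 1"
    using fundamental_matrix_factor[OF assms assms] fundamental_matrix_diag[OF assms] by simp
  then show "M 0 u ** M u 0 = mat 1" by (simp only: matrix_left_right_inverse)
qed

text \<open>The resolvent identity X^-1 - Y^-1 = - X^-1 (X - Y) Y^-1 for X = M(r, 0) and Y = M(s,
  0).\<close>

lemma fundamental_matrix_inverse_difference:
  assumes "r \<in> {0..L}" "s \<in> {0..L}"
  shows "M 0 r - M 0 s = - (M 0 r ** (M r 0 - M s 0) ** M 0 s)"
proof -
  have "M 0 r ** (M r 0 - M s 0) ** M 0 s = (M 0 r ** M r 0) ** M 0 s - M 0 r ** (M s 0 ** M 0 s)"
    by (simp add: bounded_bilinear.diff_right[OF bounded_bilinear_matrix_matrix_mult]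
        bounded_bilinear.diff_left[OF bounded_bilinear_matrix_matrix_mult] matrix_mul_assoc)
  then show ?thesis using fundamental_matrix_inverse[OF assms(1)] fundamental_matrix_inverse[OF assms(2)] by simp
qed

text \<open>The resolvent identity bounds |M(0, r) - M(0, s)| by |M(0, r)| q(r) with q(r) tending to
  0. The unknown factor |M(0, r)| is absorbed: once q(r) < 1/2, it is at most 2 |M(0, s)|.\<close>

lemma fundamental_matrix_inverse_tendsto:
  assumes s: "s \<in> {0..L}"
  shows "((\<lambda>r. M 0 r) \<longlongrightarrow> M 0 s) (at s within {0..L})"
proof -
  obtain K where K: "K > 0" "\<And>(a :: real ^ 'n ^ 'n) (b :: real ^ 'n ^ 'n). norm (a ** b) \<le> norm a * norm b * K"
    using bounded_bilinear.pos_bounded[OF bounded_bilinear_matrix_matrix_mult] by blast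
  define d where "d r = norm (M r 0 - M s 0)" for r
  define q where "q r = d r * norm (M 0 s) * K * K" for r
  have 0: "0 \<in> {0..L}" using L by simp
  have "((\<lambda>r. M r 0) \<longlongrightarrow> M s 0) (at s within {0..L})"
    using has_vector_derivative_continuous[OF fundamental_matrix_deriv[OF 0 s]] by (simp add: continuous_within)
  then have d0: "(d \<longlongrightarrow> 0) (at s within {0..L})"
    unfolding d_def by (intro tendsto_norm_zero) (simp add: LIM_zero)
  then have q0: "(q \<longlongrightarrow> 0) (at s within {0..L})"
    unfolding q_def by (intro tendsto_mult_left_zero)
  have le: "norm (M 0 r - M 0 s) \<le> norm (M 0 r) * q r" if "r \<in> {0..L}" for r
  proof -
    have "norm (M 0 r ** (M r 0 - M s 0) ** M 0 s) \<le> norm (M 0 r ** (M r 0 - M s 0)) * norm (M 0 s) * K"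
      by (rule K(2))
    also have "\<dots> \<le> (norm (M 0 r) * d r * K) * norm (M 0 s) * K"
      using K unfolding d_def by (intro mult_right_mono) auto
    finally show ?thesis
      using fundamental_matrix_inverse_difference[OF that s] by (simp add: q_def mult_ac)
  qed
  have "\<forall>\<^sub>F r in at s within {0..L}. norm (M 0 r - M 0 s) \<le> 2 * norm (M 0 s) * q r"
  proof -
    have "\<forall>\<^sub>F r in at s within {0..L}. q r < 1/2"
      using order_tendstoD(2)[OF q0, of "1/2"] by simp
    moreover have "\<forall>\<^sub>F r in at s within {0..L}. r \<in> {0..L}"
      by (auto simp: eventually_at_filter)
    ultimately show ?thesis
    proof eventually_elim
      case (elim r)
      have q: "q r \<ge> 0" using K(1) by (simp add: q_def d_def)
      have "norm (M 0 r) * q r \<le> norm (M 0 r) * (1/2)"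
        using elim by (intro mult_left_mono) auto
      moreover have "norm (M 0 r) \<le> norm (M 0 s) + norm (M 0 r - M 0 s)"
        by (rule norm_triangle_sub)
      ultimately have "norm (M 0 r) \<le> 2 * norm (M 0 s)"
        using le[OF elim(2)] by linarith
      then have "norm (M 0 r) * q r \<le> 2 * norm (M 0 s) * q r"
        using q by (rule mult_right_mono)
      then show ?case using le[OF elim(2)] by linarith
    qed
  qed
  moreover have "((\<lambda>r. 2 * norm (M 0 s) * q r) \<longlongrightarrow> 0) (at s within {0..L})"
    using q0 by (rule tendsto_mult_right_zero)
  ultimately have "((\<lambda>r. M 0 r - M 0 s) \<longlongrightarrow> 0) (at s within {0..L})"
    by (rule Lim_null_comparison)
  then show ?thesis by (simp add: LIM_zero_iff)
qed

text \<open>Differentiation of an inverse: M(0, .) has derivative - M(0, s) (A(s) M(s, 0)) M(0, s) =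
  - M(0, s) A(s). Multiplying by M(u, 0) from the left and using the factorization gives M(u,
  .).\<close>

lemma fundamental_matrix_backward_deriv:
  assumes u: "u \<in> {0..L}" and s: "s \<in> {0..L}"
  shows "((\<lambda>r. M u r) has_vector_derivative - (M u s ** A s)) (at s within {0..L})"
proof -
  have 0: "0 \<in> {0..L}" using L by simp
  have "((\<lambda>r. (M r 0 - M s 0) /\<^sub>R (r - s)) \<longlongrightarrow> A s ** M s 0) (at s within {0..L})"
    using fundamental_matrix_deriv[OF 0 s] by (simp only: has_vector_derivative_iff_quotient)
  then have "((\<lambda>r. - (M 0 r ** ((M r 0 - M s 0) /\<^sub>R (r - s)) ** M 0 s)) \<longlongrightarrow> - (M 0 s ** (A s ** M s 0) ** M 0 s))
      (at s within {0..L})"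
    by (intro tendsto_minus bounded_bilinear.tendsto[OF bounded_bilinear_matrix_matrix_mult]
        fundamental_matrix_inverse_tendsto[OF s] tendsto_const)
  also have "M 0 s ** (A s ** M s 0) ** M 0 s = M 0 s ** A s"
    by (simp add: fundamental_matrix_inverse[OF s] flip: matrix_mul_assoc)
  finally have "((\<lambda>r. (M 0 r - M 0 s) /\<^sub>R (r - s)) \<longlongrightarrow> - (M 0 s ** A s)) (at s within {0..L})"
  proof (rule Lim_transform_eventually)
    have "\<forall>\<^sub>F r in at s within {0..L}. r \<in> {0..L}"
      by (auto simp: eventually_at_filter)
    then show "\<forall>\<^sub>F r in at s within {0..L}.
        - (M 0 r ** ((M r 0 - M s 0) /\<^sub>R (r - s)) ** M 0 s) = (M 0 r - M 0 s) /\<^sub>R (r - s)"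
    proof eventually_elim
      case (elim r)
      show ?case
        unfolding fundamental_matrix_inverse_difference[OF elim s]
        by (simp only: matrix_scalar_ac scalar_matrix_assoc[symmetric] scaleR_minus_right)
    qed
  qed
  then have "(M 0 has_vector_derivative - (M 0 s ** A s)) (at s within {0..L})"
    by (simp only: has_vector_derivative_iff_quotient)
  from has_vector_derivative_matrix_mult[OF has_vector_derivative_const[of "M u 0"] this]
  have "((\<lambda>r. M u 0 ** M 0 r) has_vector_derivative - (M u s ** A s)) (at s within {0..L})"
    by (rule has_vector_derivative_eq_rhs)
      (simp add: bounded_bilinear.minus_right[OF bounded_bilinear_matrix_matrix_mult]
        matrix_mul_assoc fundamental_matrix_factor[OF u s])
  then show ?thesis
    by (rule has_vector_derivative_transform[OF s fundamental_matrix_factor[OF u], rotated])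
qed

end

section \<open>Variation of constants with a rough forcing term\<close>

text \<open>With y frozen at the left endpoint, the Stieltjes term is exactly the integral of m1(r)
  y(a), so only the oscillation of y on the cell contributes to the error.\<close>

lemma stieltjes_cell_bound:
  fixes m m1 :: "real \<Rightarrow> real ^ 'n ^ 'n" and y :: "real \<Rightarrow> real ^ 'n"
  assumes dm: "\<And>s. s \<in> {0..L} \<Longrightarrow> (m has_vector_derivative m1 s) (at s within {0..L})"
    and m1: "continuous_on {0..L} m1" and y: "continuous_on {0..L} y"
    and D: "\<And>r. r \<in> {a..b} \<Longrightarrow> norm (m1 r *v (y a - y r)) \<le> D"
    and ab: "0 \<le> a" "a \<le> b" "b \<le> L"
  shows "norm ((m b - m a) *v y a - integral {a..b} (\<lambda>r. m1 r *v y r)) \<le> D * (b - a)"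
proof -
  have sub: "{a..b} \<subseteq> {0..L}" using ab by auto
  have c1: "continuous_on {a..b} (\<lambda>r. m1 r *v y a)" and c2: "continuous_on {a..b} (\<lambda>r. m1 r *v y r)"
    using continuous_on_subset[OF m1 sub] continuous_on_subset[OF y sub]
    by (auto intro: continuous_on_matrix_vector_mult)
  have "((\<lambda>r. m1 r *v y a) has_integral (m b *v y a - m a *v y a)) {a..b}"
  proof (rule fundamental_theorem_of_calculus[OF ab(2)])
    fix x assume "x \<in> {a..b}"
    then have "x \<in> {0..L}" using sub by auto
    from has_vector_derivative_matrix_vector_mult[OF dm[OF this] has_vector_derivative_const[of "y a"]]
    show "((\<lambda>x. m x *v y a) has_vector_derivative m1 x *v y a) (at x within {a..b})"
      by (intro has_vector_derivative_within_subset[OF _ sub]) simp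
  qed
  then have "(m b - m a) *v y a = integral {a..b} (\<lambda>r. m1 r *v y a)"
    by (simp add: integral_unique matrix_vector_mult_diff_rdistrib)
  then have "(m b - m a) *v y a - integral {a..b} (\<lambda>r. m1 r *v y r) =
      integral {a..b} (\<lambda>r. m1 r *v y a - m1 r *v y r)"
    using c1 c2 by (simp add: Henstock_Kurzweil_Integration.integral_diff integrable_continuous_real)
  also have "norm \<dots> \<le> D * (b - a)"
    using ab(2)
  proof (rule integral_bound)
    show "continuous_on {a..b} (\<lambda>r. m1 r *v y a - m1 r *v y r)"
      using c1 c2 by (intro continuous_intros)
  qed (use D in \<open>simp add: matrix_vector_mult_diff_distrib\<close>)
  finally show ?thesis .
qed

lemma stieltjes_sum_tendsto:
  fixes m m1 :: "real \<Rightarrow> real ^ 'n ^ 'n" and y :: "real \<Rightarrow> real ^ 'n"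
  assumes dm: "\<And>s. s \<in> {0..L} \<Longrightarrow> (m has_vector_derivative m1 s) (at s within {0..L})"
    and m1: "continuous_on {0..L} m1" and y: "continuous_on {0..L} y" and L: "0 \<le> L"
  shows "(\<lambda>N. \<Sum>k<Suc N. (m (uniform_grid L N (Suc k)) - m (uniform_grid L N k)) *v y (uniform_grid L N k))
    \<longlonglongrightarrow> integral {0..L} (\<lambda>r. m1 r *v y r)"
proof (rule tendstoI)
  fix e :: real assume e: "e > 0"
  obtain K where K: "K > 0" "\<And>(a :: real ^ 'n ^ 'n) (b :: real ^ 'n). norm (a *v b) \<le> norm a * norm b * K"
    using bounded_bilinear.pos_bounded[OF bounded_bilinear_matrix_vector_mult] by blast
  obtain C where C: "C > 0" "\<And>s. s \<in> {0..L} \<Longrightarrow> norm (m1 s) \<le> C"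
    using compact_imp_bounded[OF compact_continuous_image[OF m1 compact_Icc]]
    unfolding bounded_pos by blast
  \<comment> \<open>Makes the total error C \<eta> K L equal to e L / (2 (L + 1)), hence below e,
    with L = 0 allowed.\<close>
  define \<eta> where "\<eta> = e / (2 * C * K * (L + 1))"
  have \<eta>: "\<eta> > 0" using e C K L by (simp add: \<eta>_def)
  have small: "C * \<eta> * K * L < e"
  proof -
    have "C * \<eta> * K * L = e * (L / (2 * (L + 1)))" using C K by (simp add: \<eta>_def)
    also have "\<dots> < e * 1" using e L by (intro mult_strict_left_mono) (auto simp: divide_simps)
    finally show ?thesis by simp
  qed
  have "uniformly_continuous_on {0..L} y"
    using y by (intro compact_uniformly_continuous) auto
  then obtain d where d: "d > 0"
    and yd: "\<And>x y'. x \<in> {0..L} \<Longrightarrow> y' \<in> {0..L} \<Longrightarrow> dist y' x < d \<Longrightarrow> dist (y y') (y x) < \<eta>"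
    using \<eta> unfolding uniformly_continuous_on_def by metis
  show "\<forall>\<^sub>F N in sequentially. dist (\<Sum>k<Suc N. (m (uniform_grid L N (Suc k)) - m (uniform_grid L N k)) *v y (uniform_grid L N k))
      (integral {0..L} (\<lambda>r. m1 r *v y r)) < e"
    using eventually_uniform_grid_width[OF d, of L]
  proof eventually_elim
    case (elim N)
    let ?\<tau> = "uniform_grid L N"
    note p = is_partition_uniform_grid[OF L, of N]
    have cell: "norm ((m (?\<tau> (Suc k)) - m (?\<tau> k)) *v y (?\<tau> k) - integral {?\<tau> k..?\<tau> (Suc k)} (\<lambda>r. m1 r *v y r))
        \<le> (C * \<eta> * K) * (?\<tau> (Suc k) - ?\<tau> k)" if k: "k < Suc N" for k
    proof (rule stieltjes_cell_bound[OF dm m1 y])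
      show b: "0 \<le> ?\<tau> k" "?\<tau> k \<le> ?\<tau> (Suc k)" "?\<tau> (Suc k) \<le> L"
        using uniform_grid_in[OF L, of k N] uniform_grid_in[OF L, of "Suc k" N] partition_mono[OF p, of k "Suc k"] k by auto
      fix r assume r: "r \<in> {?\<tau> k..?\<tau> (Suc k)}"
      have rL: "r \<in> {0..L}" "?\<tau> k \<in> {0..L}" using r b by auto
      have "dist (?\<tau> k) r < d"
        using r elim uniform_grid_width[of L N k] by (auto simp: dist_real_def)
      then have "norm (y (?\<tau> k) - y r) \<le> \<eta>"
        using yd[OF rL] by (simp add: dist_norm)
      then have "norm (m1 r) * norm (y (?\<tau> k) - y r) * K \<le> C * \<eta> * K"
        using C(1) C(2)[OF rL(1)] K(1) \<eta> by (intro mult_right_mono mult_mono) auto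
      then show "norm (m1 r *v (y (?\<tau> k) - y r)) \<le> C * \<eta> * K"
        using K(2) order_trans by blast
    qed
    \<comment> \<open>The error of a partial sum is bounded in proportion to the length already
      covered, so the induction adds one cell at a time.\<close>
    have "norm ((\<Sum>j<k. (m (?\<tau> (Suc j)) - m (?\<tau> j)) *v y (?\<tau> j)) - integral {0..?\<tau> k} (\<lambda>r. m1 r *v y r))
        \<le> (C * \<eta> * K) * ?\<tau> k" if "k \<le> Suc N" for k
      using that
    proof (induction k)
      case 0
      then show ?case by (simp add: uniform_grid_def)
    next
      case (Suc k)
      let ?S = "\<Sum>j<k. (m (?\<tau> (Suc j)) - m (?\<tau> j)) *v y (?\<tau> j)" and ?f = "\<lambda>r. m1 r *v y r"
      have b: "0 \<le> ?\<tau> k" "?\<tau> k \<le> ?\<tau> (Suc k)" "?\<tau> (Suc k) \<le> L"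
        using uniform_grid_in[OF L, of k N] uniform_grid_in[OF L, of "Suc k" N] partition_mono[OF p, of k "Suc k"] Suc by auto
      have "?f integrable_on {0..?\<tau> (Suc k)}"
        using b m1 y by (intro integrable_continuous_real continuous_on_matrix_vector_mult)
          (auto intro: continuous_on_subset)
      then have split: "integral {0..?\<tau> (Suc k)} ?f = integral {0..?\<tau> k} ?f + integral {?\<tau> k..?\<tau> (Suc k)} ?f"
        using b by (intro Henstock_Kurzweil_Integration.integral_combine[symmetric]) auto
      have "norm ((?S + (m (?\<tau> (Suc k)) - m (?\<tau> k)) *v y (?\<tau> k)) - integral {0..?\<tau> (Suc k)} ?f)
          \<le> norm (?S - integral {0..?\<tau> k} ?f)
            + norm ((m (?\<tau> (Suc k)) - m (?\<tau> k)) *v y (?\<tau> k) - integral {?\<tau> k..?\<tau> (Suc k)} ?f)"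
        unfolding split by (rule norm_diff_triangle_ineq)
      also have "\<dots> \<le> (C * \<eta> * K) * ?\<tau> k + (C * \<eta> * K) * (?\<tau> (Suc k) - ?\<tau> k)"
        using Suc by (intro add_mono cell) auto
      finally show ?case by (simp add: algebra_simps)
    qed
    from this[of "Suc N"] have "norm ((\<Sum>j<Suc N. (m (?\<tau> (Suc j)) - m (?\<tau> j)) *v y (?\<tau> j)) - integral {0..L} (\<lambda>r. m1 r *v y r))
        \<le> (C * \<eta> * K) * L"
      using p by (simp add: is_partition_def del: sum.lessThan_Suc)
    then show ?case using small by (simp only: dist_norm)
  qed
qed

text \<open>Weights at right endpoints on the left leave y at left endpoints on the right, which is
  the kind of sum treated in \<open>stieltjes_sum_tendsto\<close>.\<close>

lemma abel_summation_matrix: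
  fixes a :: "nat \<Rightarrow> real ^ 'n ^ 'n" and y :: "nat \<Rightarrow> real ^ 'n"
  shows "(\<Sum>k<n. a (Suc k) *v (y (Suc k) - y k)) =
    a n *v y n - a 0 *v y 0 - (\<Sum>k<n. (a (Suc k) - a k) *v y k)"
  by (induction n) (simp_all add: matrix_vector_mult_diff_distrib matrix_vector_mult_diff_rdistrib)

text \<open>With \<open>\<phi> = \<psi> - y\<close>, which is differentiable, \<open>M(L, s) \<phi>(s)\<close> has derivative \<open>M(L, s) A(s) y(s)\<close>;
  this and summation by parts turn the rough term into a Stieltjes sum against \<open>M(L, \<cdot>)\<close>.\<close>

lemma variation_of_constants_rough:
  fixes \<psi> y :: "real \<Rightarrow> real ^ 'n"
  assumes A: "continuous_on {0..L} A" and M: "fundamental_matrix A {0..L} M" and L: "0 \<le> L"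
    and \<psi>: "continuous_on {0..L} \<psi>"
    and y: "\<And>s. s \<in> {0..L} \<Longrightarrow> \<psi> s = \<psi> 0 + integral {0..s} (\<lambda>r. A r *v \<psi> r) + y s"
  shows "(\<lambda>N. \<Sum>k<Suc N. M L (uniform_grid L N (Suc k)) *v (y (uniform_grid L N (Suc k)) - y (uniform_grid L N k)))
    \<longlonglongrightarrow> \<psi> L - M L 0 *v \<psi> 0"
proof -
  have 0: "0 \<in> {0..L}" and LL: "L \<in> {0..L}" using L by auto
  define \<phi> where "\<phi> s = \<psi> 0 + integral {0..s} (\<lambda>r. A r *v \<psi> r)" for s
  define m1 where "m1 s = - (M L s ** A s)" for s
  have dm: "(M L has_vector_derivative m1 s) (at s within {0..L})" if "s \<in> {0..L}" for s
    unfolding m1_def by (rule fundamental_matrix_backward_deriv[OF A M L LL that])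
  then have cm: "continuous_on {0..L} (M L)"
    by (rule continuous_on_vector_derivative)
  have m1: "continuous_on {0..L} m1"
    unfolding m1_def by (intro continuous_intros continuous_on_matrix_mult cm A)
  have cA\<psi>: "continuous_on {0..L} (\<lambda>r. A r *v \<psi> r)"
    by (intro continuous_on_matrix_vector_mult A \<psi>)
  have d\<phi>: "(\<phi> has_vector_derivative A s *v \<psi> s) (at s within {0..L})" if "s \<in> {0..L}" for s
    using has_vector_derivative_add[OF has_vector_derivative_const integral_has_vector_derivative[OF cA\<psi> that]]
    by (simp add: \<phi>_def[abs_def])
  then have c\<phi>: "continuous_on {0..L} \<phi>"
    by (rule continuous_on_vector_derivative)
  have y_eq: "y s = \<psi> s - \<phi> s" if "s \<in> {0..L}" for s
    using y[OF that] by (simp add: \<phi>_def)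
  then have cy: "continuous_on {0..L} y"
    by (intro continuous_on_eq[OF continuous_on_diff[OF \<psi> c\<phi>]]) simp
  have "((\<lambda>s. - (m1 s *v y s)) has_integral (M L L *v \<phi> L - M L 0 *v \<phi> 0)) {0..L}"
  proof (rule fundamental_theorem_of_calculus[OF L])
    fix s assume s: "s \<in> {0..L}"
    show "((\<lambda>s. M L s *v \<phi> s) has_vector_derivative - (m1 s *v y s)) (at s within {0..L})"
      using has_vector_derivative_matrix_vector_mult[OF dm[OF s] d\<phi>[OF s]]
      by (rule has_vector_derivative_eq_rhs)
        (simp add: y_eq[OF s] m1_def matrix_vector_mul_assoc matrix_vector_mult_diff_distrib
          bounded_bilinear.minus_left[OF bounded_bilinear_matrix_vector_mult])
  qed
  from integral_unique[OF this] have by_parts: "- integral {0..L} (\<lambda>s. m1 s *v y s) = \<phi> L - M L 0 *v \<psi> 0"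
    by (simp add: fundamental_matrix_diag[OF A M L LL] \<phi>_def)
  have lim: "(\<lambda>N. y L - (\<Sum>k<Suc N. (M L (uniform_grid L N (Suc k)) - M L (uniform_grid L N k)) *v y (uniform_grid L N k)))
      \<longlonglongrightarrow> y L - integral {0..L} (\<lambda>s. m1 s *v y s)"
    by (intro tendsto_diff tendsto_const stieltjes_sum_tendsto[OF dm m1 cy L])
  have sum_eq: "(\<Sum>k<Suc N. M L (uniform_grid L N (Suc k)) *v (y (uniform_grid L N (Suc k)) - y (uniform_grid L N k)))
      = y L - (\<Sum>k<Suc N. (M L (uniform_grid L N (Suc k)) - M L (uniform_grid L N k)) *v y (uniform_grid L N k))" for N
  proof -
    \<comment> \<open>Of the boundary terms only \<open>y L\<close> survives, because
      \<open>y 0\<close> vanishes and \<open>M L L\<close> is the identity.\<close>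
    have "y 0 = 0" using y[OF 0] by simp
    moreover have "uniform_grid L N 0 = 0" "uniform_grid L N (Suc N) = L"
      using is_partition_uniform_grid[OF L, of N] by (auto simp: is_partition_def)
    ultimately show ?thesis
      using abel_summation_matrix[of "\<lambda>k. M L (uniform_grid L N k)" "\<lambda>k. y (uniform_grid L N k)" "Suc N"]
        fundamental_matrix_diag[OF A M L LL] by (simp del: sum.lessThan_Suc)
  qed
  have "\<psi> L - M L 0 *v \<psi> 0 = y L - integral {0..L} (\<lambda>s. m1 s *v y s)"
    using by_parts y_eq[OF LL] by (simp add: algebra_simps)
  then show ?thesis
    unfolding sum_eq using lim by (simp only:)
qed

section \<open>The change of clock\<close>

context
  fixes K :: "real \<Rightarrow> real" and T :: real and S :: "real \<Rightarrow> real"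
  assumes K: "K absolutely_integrable_on {0..T}" and pos: "AE r in lebesgue_on {0..T}. K r > 0"
    and T: "0 \<le> T" and S: "S = (\<lambda>r. integral {0..r} K)"
begin

lemma clock_zero: "S 0 = 0"
  by (simp add: S)

lemma clock_integrable: "0 \<le> a \<Longrightarrow> b \<le> T \<Longrightarrow> integrable (lebesgue_on {a..b}) K"
  using K by (intro absolutely_integrable_imp_integrable absolutely_integrable_on_subinterval[OF K]) auto

lemma clock_AE_pos:
  assumes "0 \<le> a" "b \<le> T"
  shows "AE r in lebesgue_on {a..b}. K r > 0"
proof -
  have "AE r in lebesgue. r \<in> {0..T} \<longrightarrow> K r > 0"
    using pos by (simp add: AE_restrict_space_iff)
  then have "AE r in lebesgue. r \<in> {a..b} \<longrightarrow> K r > 0"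
    by (rule eventually_mono) (use assms in auto)
  then show ?thesis by (simp add: AE_restrict_space_iff)
qed

lemma clock_difference:
  assumes "0 \<le> a" "a \<le> b" "b \<le> T"
  shows "S b - S a = (\<integral>r. K r \<partial>lebesgue_on {a..b})"
proof -
  have "K integrable_on {0..b}"
    using clock_integrable[of 0 b] assms by (intro integrable_on_lebesgue_on) auto
  then have "integral {0..a} K + integral {a..b} K = integral {0..b} K"
    using assms by (intro Henstock_Kurzweil_Integration.integral_combine) auto
  moreover have "(\<integral>r. K r \<partial>lebesgue_on {a..b}) = integral {a..b} K"
    using clock_integrable[of a b] assms by (intro lebesgue_integral_eq_integral) auto
  ultimately show ?thesis by (simp add: S)
qed

text \<open>If the increment were zero, the nonnegative K would vanish almost everywhere on
  \<open>{a..b}\<close>, an interval of positive length on which it is also positive almost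
  everywhere.\<close>

lemma clock_strict:
  assumes "0 \<le> a" "a < b" "b \<le> T"
  shows "S a < S b"
proof -
  let ?l = "lebesgue_on {a..b}"
  have p: "AE r in ?l. K r > 0" using clock_AE_pos assms by simp
  then have nn: "AE r in ?l. 0 \<le> K r" by (rule eventually_mono) simp
  have int: "integrable ?l K" using clock_integrable assms by simp
  have "(\<integral>r. K r \<partial>?l) \<noteq> 0"
  proof
    assume "(\<integral>r. K r \<partial>?l) = 0"
    then have "AE r in ?l. K r = 0"
      using integral_nonneg_eq_0_iff_AE[OF int nn] by simp
    with p have "AE r in ?l. False" by eventually_elim simp
    then obtain N where "{r \<in> space ?l. \<not> False} \<subseteq> N" "emeasure ?l N = 0" "N \<in> sets ?l"
      by (rule AE_E)
    then have "emeasure ?l (space ?l) = 0"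
      using emeasure_mono[of "space ?l" N ?l] by (simp add: subset_iff)
    moreover have "emeasure ?l (space ?l) = ennreal (b - a)"
      using assms by (simp add: emeasure_restrict_space)
    ultimately show False using assms by simp
  qed
  moreover have "(\<integral>r. K r \<partial>?l) \<ge> 0" using nn by (rule integral_nonneg_AE)
  ultimately show ?thesis using clock_difference[of a b] assms by simp
qed

lemma clock_mono: "0 \<le> a \<Longrightarrow> a \<le> b \<Longrightarrow> b \<le> T \<Longrightarrow> S a \<le> S b"
  using clock_strict[of a b] by (cases "a = b") auto

lemma clock_nonneg: "0 \<le> S T"
  using clock_mono[of 0 T] clock_zero T by simp

lemma clock_inj: "inj_on S {0..T}"
proof (rule inj_onI)
  fix x y assume "x \<in> {0..T}" "y \<in> {0..T}" "S x = S y"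
  then show "x = y" using clock_strict[of x y] clock_strict[of y x] by (cases x y rule: linorder_cases) auto
qed

lemma clock_continuous: "continuous_on {0..T} S"
  unfolding S using clock_integrable[of 0 T]
  by (intro indefinite_integral_continuous_1 integrable_on_lebesgue_on) auto

lemma clock_image: "S ` {0..T} = {0..S T}"
proof
  show "S ` {0..T} \<subseteq> {0..S T}"
    using clock_mono[of 0] clock_mono[of _ T] clock_zero by auto
  show "{0..S T} \<subseteq> S ` {0..T}"
  proof
    fix y assume y: "y \<in> {0..S T}"
    have "\<exists>x. 0 \<le> x \<and> x \<le> T \<and> S x = y"
      by (rule IVT') (use y clock_zero T clock_continuous in auto)
    then show "y \<in> S ` {0..T}" by auto
  qed
qed

text \<open>The endpoint a is null and may belong to J or not: the half-open form serves preimages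
  of open rays, the closed one the whole interval.\<close>

lemma clock_density_tail:
  assumes a: "a \<in> {0..T}" and J: "J \<in> sets borel" "{a<..T} \<subseteq> J" "J \<subseteq> {a..T}"
  shows "emeasure (density (lebesgue_on {0..T}) (\<lambda>r. ennreal (K r))) J = ennreal (S T - S a)"
proof -
  have [measurable]: "K \<in> borel_measurable (lebesgue_on {0..T})"
    using clock_integrable[of 0 T] by auto
  have JL: "J \<in> sets (lebesgue_on {0..T})"
    using J a by (subst sets_restrict_space_iff) (auto intro!: sets_completionI_sets)
  have "emeasure (density (lebesgue_on {0..T}) (\<lambda>r. ennreal (K r))) J = (\<integral>\<^sup>+r. ennreal (K r) * indicator J r \<partial>lebesgue_on {0..T})"
    using JL by (simp add: emeasure_density)
  also have "\<dots> = (\<integral>\<^sup>+r. ennreal (K r) * indicator J r * indicator {0..T} r \<partial>lebesgue)"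
    by (simp add: nn_integral_restrict_space)
  also have "\<dots> = (\<integral>\<^sup>+r. ennreal (K r) * indicator {a..T} r \<partial>lebesgue)"
  proof (intro nn_integral_cong_AE)
    have "AE r in lebesgue. r \<noteq> a"
      by (intro AE_completion AE_lborel_singleton)
    then show "AE r in lebesgue. ennreal (K r) * indicator J r * indicator {0..T} r = ennreal (K r) * indicator {a..T} r"
    proof eventually_elim
      case (elim r)
      then have "r \<in> J \<and> r \<in> {0..T} \<longleftrightarrow> r \<in> {a..T}" using J a by force
      then show ?case by (auto simp: indicator_def)
    qed
  qed
  also have "\<dots> = (\<integral>\<^sup>+r. ennreal (K r) \<partial>lebesgue_on {a..T})"
    by (simp add: nn_integral_restrict_space)
  also have "\<dots> = ennreal (\<integral>r. K r \<partial>lebesgue_on {a..T})"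
    using a clock_AE_pos[of a T] by (intro nn_integral_eq_integral clock_integrable) (auto elim: eventually_mono)
  also have "\<dots> = ennreal (S T - S a)"
    using a clock_difference[of a T] by simp
  finally show ?thesis .
qed

lemma clock_measurable: "S \<in> borel_measurable (density (lebesgue_on {0..T}) (\<lambda>r. ennreal (K r)))"
  using continuous_imp_measurable_on_sets_lebesgue[OF clock_continuous] by simp

text \<open>The substitution ds = K dt in the form of measures. Open upper rays with finite mass
  determine a Borel measure, and strict monotonicity of S turns the preimage of such a ray into an
  interval with right end T, whose mass is an increment of S.\<close>

lemma clock_pushforward:
  "distr (density (lebesgue_on {0..T}) (\<lambda>r. ennreal (K r))) borel S = distr (lebesgue_on {0..S T}) borel (\<lambda>s. s)"
    (is "?N = ?N'")
proof (rule measure_eqI_lessThan)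
  let ?\<nu> = "density (lebesgue_on {0..T}) (\<lambda>r. ennreal (K r))"
  have id: "(\<lambda>s. s) \<in> borel_measurable (lebesgue_on {0..S T})"
    by (intro measurable_restrict_space1 measurable_completion) simp
  have N: "emeasure ?N {x<..} = emeasure ?\<nu> (S -` {x<..} \<inter> {0..T})" for x
    using clock_measurable by (simp add: emeasure_distr)
  have N': "emeasure ?N' {x<..} = emeasure lborel ({x<..} \<inter> {0..S T})" for x
    using id by (subst emeasure_distr) (auto simp: emeasure_restrict_space)
  have eq: "emeasure ?N {x<..} = emeasure ?N' {x<..} \<and> emeasure ?N' {x<..} < \<infinity>" for x
  proof -
    consider "x < 0" | "x \<in> {0..S T}" | "S T < x" by fastforce
    then show ?thesis
    proof cases
      case 1
      then have "S -` {x<..} \<inter> {0..T} = {0..T}" "{x<..} \<inter> {0..S T} = {0..S T}"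
        using clock_image by force+
      moreover have "emeasure ?\<nu> {0..T} = ennreal (S T - S 0)"
        by (rule clock_density_tail) (use T in auto)
      ultimately show ?thesis
        unfolding N N' using clock_zero clock_nonneg by simp
    next
      case 2
      then obtain a where a: "a \<in> {0..T}" "x = S a" using clock_image by blast
      have "x < S r \<longleftrightarrow> a < r" if "r \<in> {0..T}" for r
        using clock_strict[of a r] clock_mono[of r a] a that by fastforce
      then have "S -` {x<..} \<inter> {0..T} = {a<..T}"
        using a by auto
      moreover have "{x<..} \<inter> {0..S T} = {x<..S T}" using 2 by auto
      moreover have "emeasure ?\<nu> {a<..T} = ennreal (S T - S a)"
        by (rule clock_density_tail) (use a in auto)
      ultimately show ?thesis
        unfolding N N' using a 2 by simp
    next
      case 3
      then have "S -` {x<..} \<inter> {0..T} = {}" "{x<..} \<inter> {0..S T} = {}"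
        using clock_mono[of _ T] by force+
      then show ?thesis unfolding N N' by simp
    qed
  qed
  then show "emeasure ?N {x<..} = emeasure ?N' {x<..}" "emeasure ?N {x<..} < \<infinity>" for x
    by auto
qed auto

text \<open>The pushforward identity is used instead of the fact that an absolutely continuous function maps
  null sets to null sets.\<close>

lemma clock_inverse_AE_pos:
  assumes t: "t = the_inv_into {0..T} S"
  shows "AE s in lebesgue_on {0..S T}. K (t s) > 0"
proof -
  let ?\<nu> = "density (lebesgue_on {0..T}) (\<lambda>r. ennreal (K r))"
  have tS: "t (S r) = r" if "r \<in> {0..T}" for r
    unfolding t using the_inv_into_f_f[OF clock_inj that] .
  have ct: "continuous_on {0..S T} t"
    unfolding clock_image[symmetric]
    by (rule continuous_on_inv[OF clock_continuous]) (auto simp: tS)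
  \<comment> \<open>The exceptional set is enlarged to a Borel null set. Its preimage Q under the
    continuous t is then Borel, as the comparison of the two pushforwards on Q requires.\<close>
  have "AE r in lborel. r \<in> {0..T} \<longrightarrow> K r > 0"
    using pos by (simp add: AE_restrict_space_iff AE_completion_iff)
  then obtain N0 where N0: "{r. \<not> (r \<in> {0..T} \<longrightarrow> K r > 0)} \<subseteq> N0" "emeasure lborel N0 = 0" "N0 \<in> sets borel"
    by (auto elim!: AE_E)
  define Q where "Q = t -` N0 \<inter> {0..S T}"
  have Q: "Q \<in> sets borel"
    using measurable_sets[OF borel_measurable_continuous_on_restrict[OF ct] N0(3)]
    by (simp add: Q_def space_restrict_space sets_restrict_space_iff)
  have "AE r in lebesgue. r \<notin> N0"
    using N0 by (intro AE_completion AE_not_in) (auto simp: null_sets_def)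
  then have "AE r in lebesgue_on {0..T}. r \<notin> N0"
    by (auto simp: AE_restrict_space_iff elim: eventually_mono)
  then have "AE r in ?\<nu>. r \<notin> N0"
    using clock_integrable[of 0 T] by (subst AE_density) (auto elim: eventually_mono)
  then have "AE r in ?\<nu>. \<not> (r \<in> {0..T} \<and> S r \<in> Q)"
    by (rule eventually_mono) (auto simp: Q_def tS)
  from emeasure_eq_0_AE[OF this] have "emeasure ?\<nu> (S -` Q \<inter> space ?\<nu>) = 0"
    by (rule back_subst[of "\<lambda>X. emeasure ?\<nu> X = 0"]) auto
  then have "emeasure (distr (lebesgue_on {0..S T}) borel (\<lambda>s. s)) Q = 0"
    unfolding clock_pushforward[symmetric] using Q clock_measurable by (simp add: emeasure_distr)
  moreover have "(\<lambda>s. s) \<in> borel_measurable (lebesgue_on {0..S T})"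
    by (intro measurable_restrict_space1 measurable_completion) simp
  ultimately have null: "Q \<in> null_sets (lebesgue_on {0..S T})"
  proof (intro null_setsI)
    show "Q \<in> sets (lebesgue_on {0..S T})"
      using Q by (subst sets_restrict_space_iff) (auto simp: Q_def intro!: sets_completionI_sets)
    assume "emeasure (distr (lebesgue_on {0..S T}) borel (\<lambda>s. s)) Q = 0"
      and "(\<lambda>s. s) \<in> borel_measurable (lebesgue_on {0..S T})"
    then show "emeasure (lebesgue_on {0..S T}) Q = 0"
      using Q by (simp add: emeasure_distr Q_def Int_absorb2)
  qed
  show ?thesis
  proof (rule AE_I'[OF null], safe)
    fix s assume s: "s \<in> space (lebesgue_on {0..S T})" "\<not> 0 < K (t s)"
    then have "s \<in> S ` {0..T}" by (simp add: clock_image)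
    then obtain r where r: "r \<in> {0..T}" "s = S r" by (rule imageE)
    then have "t s = r" by (simp only: tS)
    then have "t s \<in> N0" using N0(1) s(2) r(1) by blast
    then show "s \<in> Q" using s(1) by (simp add: Q_def)
  qed
qed

end

section \<open>The Jacobian of the coupling field\<close>

lemma has_derivative_vec:
  fixes f :: "'a :: real_normed_vector \<Rightarrow> real ^ 'n"
  assumes "\<And>i. ((\<lambda>x. f x $ i) has_derivative (\<lambda>h. f' h $ i)) (at x)"
  shows "(f has_derivative f') (at x)"
  using assms
  by (subst has_derivative_componentwise_within) (auto simp: Basis_vec_def inner_axis)

lemma coupling_field_has_derivative:
  fixes G :: "real ^ 'n ^ 'n"
  shows "(coupling_field G has_derivative
    (\<lambda>h. \<chi> i. \<Sum>j\<in>UNIV. G $ i $ j * (cos (\<theta> $ j - \<theta> $ i) * (h $ j - h $ i)))) (at \<theta>)"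
proof (rule has_derivative_vec)
  fix i
  have "((\<lambda>\<theta>. \<Sum>j\<in>UNIV. G $ i $ j * sin (\<theta> $ j - \<theta> $ i)) has_derivative
      (\<lambda>h. \<Sum>j\<in>UNIV. G $ i $ j * (cos (\<theta> $ j - \<theta> $ i) * (h $ j - h $ i)))) (at \<theta>)"
    by (auto intro!: derivative_eq_intros bounded_linear.has_derivative[OF bounded_linear_vec_nth]
        simp: mult.commute)
  then show "((\<lambda>\<theta>. coupling_field G \<theta> $ i) has_derivative
      (\<lambda>h. (\<chi> i. \<Sum>j\<in>UNIV. G $ i $ j * (cos (\<theta> $ j - \<theta> $ i) * (h $ j - h $ i))) $ i)) (at \<theta>)"
    by (simp add: coupling_field_def)
qed

text \<open>The entries are visibly continuous in \<theta>, which yields continuity of A along the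
  orbit.\<close>

lemma jacobian_coupling_field:
  fixes G :: "real ^ 'n ^ 'n"
  shows "jacobian (coupling_field G) (at \<theta>) =
    (\<chi> i k. \<Sum>j\<in>UNIV. G $ i $ j * (cos (\<theta> $ j - \<theta> $ i) * (axis k 1 $ j - axis k 1 $ i)))"
  unfolding jacobian_def frechet_derivative_at[OF coupling_field_has_derivative, symmetric]
  by (simp add: matrix_def)

lemma continuous_on_jacobian_coupling_field:
  fixes G :: "real ^ 'n ^ 'n" and \<theta> :: "real \<Rightarrow> real ^ 'n"
  assumes "continuous_on I \<theta>"
  shows "continuous_on I (\<lambda>s. jacobian (coupling_field G) (at (\<theta> s)))"
  unfolding jacobian_coupling_field by (intro continuous_intros assms)

section \<open>Covariance of the linear equation\<close>

lemma square_integrable_iff_L2: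
  "square_integrable P X \<longleftrightarrow> X \<in> borel_measurable P \<and> (\<forall>i. L2 P (\<lambda>\<omega>. X \<omega> $ i))"
proof (cases "X \<in> borel_measurable P")
  case True
  then have m: "(\<lambda>\<omega>. X \<omega> $ i) \<in> borel_measurable P" for i
    by (intro measurable_compose[OF _ borel_measurable_vec_nth])
  have n: "(norm (X \<omega>))\<^sup>2 = (\<Sum>i\<in>UNIV. (X \<omega> $ i)\<^sup>2)" for \<omega>
    unfolding power2_norm_eq_inner inner_vec_def by (simp add: power2_eq_square)
  show ?thesis
  proof
    assume "square_integrable P X"
    then have int: "integrable P (\<lambda>\<omega>. (norm (X \<omega>))\<^sup>2)" by (simp add: square_integrable_def)
    have le: "(X \<omega> $ i)\<^sup>2 \<le> (norm (X \<omega>))\<^sup>2" for \<omega> i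
      by (metis abs_ge_zero component_le_norm_cart power2_abs power_mono)
    have "integrable P (\<lambda>\<omega>. (X \<omega> $ i)\<^sup>2)" for i
      by (rule Bochner_Integration.integrable_bound[OF int]) (use m[of i] le in auto)
    then show "X \<in> borel_measurable P \<and> (\<forall>i. L2 P (\<lambda>\<omega>. X \<omega> $ i))"
      using True m by (auto simp: L2_def)
  next
    assume "X \<in> borel_measurable P \<and> (\<forall>i. L2 P (\<lambda>\<omega>. X \<omega> $ i))"
    then show "square_integrable P X"
      using True by (auto simp: square_integrable_def n L2_def)
  qed
qed (simp add: square_integrable_def)

text \<open>After centering, the vector is R (X - E X) + Z. The mixed terms vanish because Z has
  mean zero and is orthogonal to X, and the first term alone produces the conjugation by R.\<close>

lemma covariance_affine:
  fixes X Y Z :: "'a \<Rightarrow> real ^ 'n" and R :: "real ^ 'n ^ 'n"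
  assumes prob: "prob_space P" and X: "\<And>i. L2 P (\<lambda>\<omega>. X \<omega> $ i)" and Z: "\<And>i. L2 P (\<lambda>\<omega>. Z \<omega> $ i)"
    and mean: "\<And>i. (\<integral>\<omega>. Z \<omega> $ i \<partial>P) = 0" and orth: "\<And>i j. (\<integral>\<omega>. X \<omega> $ i * Z \<omega> $ j \<partial>P) = 0"
  shows "covariance_matrix P (\<lambda>\<omega>. R *v X \<omega> + Z \<omega>) $ i $ j =
    (R ** covariance_matrix P X ** transpose R) $ i $ j + (\<integral>\<omega>. Z \<omega> $ i * Z \<omega> $ j \<partial>P)"
proof -
  interpret prob_space P by (rule prob)
  note intX = L2_integrable[OF X] and intZ = L2_integrable[OF Z]
  define C where "C k \<omega> = X \<omega> $ k - expectation (\<lambda>\<eta>. X \<eta> $ k)" for k \<omega>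
  define U where "U i \<omega> = (\<Sum>k\<in>UNIV. R $ i $ k * C k \<omega>)" for i \<omega>
  have "L2 P (\<lambda>_. c)" for c
    by (auto simp: L2_def)
  then have C: "L2 P (C k)" for k
    unfolding C_def[abs_def] by (intro L2_diff X)
  then have U: "L2 P (U i)" for i
    unfolding U_def[abs_def] by (intro L2_sum L2_cmult)
  have CZ: "(\<integral>\<omega>. C k \<omega> * Z \<omega> $ j \<partial>P) = 0" for k j
    using L2_mult_integrable[OF X Z] intZ by (simp add: C_def left_diff_distrib orth mean)
  have UZ: "(\<integral>\<omega>. U i \<omega> * Z \<omega> $ j \<partial>P) = 0" for i j
    using L2_mult_integrable[OF C Z]
    by (simp add: U_def sum_distrib_right mult.assoc Bochner_Integration.integral_sum CZ)
  have UU: "(\<integral>\<omega>. U i \<omega> * U j \<omega> \<partial>P) = (R ** covariance_matrix P X ** transpose R) $ i $ j"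
  proof -
    have "(\<integral>\<omega>. U i \<omega> * U j \<omega> \<partial>P) = (\<Sum>k\<in>UNIV. \<Sum>l\<in>UNIV. R $ i $ k * R $ j $ l * (\<integral>\<omega>. C k \<omega> * C l \<omega> \<partial>P))"
      unfolding U_def by (rule L2_inner_sum[OF C C])
    also have "\<dots> = (\<Sum>l\<in>UNIV. \<Sum>k\<in>UNIV. R $ i $ k * R $ j $ l * (\<integral>\<omega>. C k \<omega> * C l \<omega> \<partial>P))"
      by (rule sum.swap)
    also have "\<dots> = (R ** covariance_matrix P X ** transpose R) $ i $ j"
      by (simp add: matrix_matrix_mult_def transpose_def covariance_matrix_def C_def sum_distrib_right sum_distrib_left mult_ac)
    finally show ?thesis .
  qed
  have center: "(R *v X \<omega> + Z \<omega>) $ i - expectation (\<lambda>\<eta>. (R *v X \<eta> + Z \<eta>) $ i) = U i \<omega> + Z \<omega> $ i" for i \<omega>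
  proof -
    have "expectation (\<lambda>\<eta>. (R *v X \<eta> + Z \<eta>) $ i) = (\<Sum>k\<in>UNIV. R $ i $ k * expectation (\<lambda>\<eta>. X \<eta> $ k))"
      using intX intZ by (simp add: matrix_vector_mult_def Bochner_Integration.integral_add Bochner_Integration.integral_sum mean)
    then show ?thesis
      by (simp add: matrix_vector_mult_def U_def C_def right_diff_distrib sum_subtractf)
  qed
  have "covariance_matrix P (\<lambda>\<omega>. R *v X \<omega> + Z \<omega>) $ i $ j = (\<integral>\<omega>. (U i \<omega> + Z \<omega> $ i) * (U j \<omega> + Z \<omega> $ j) \<partial>P)"
    unfolding covariance_matrix_def center by simp
  also have "\<dots> = (\<integral>\<omega>. U i \<omega> * U j \<omega> + U i \<omega> * Z \<omega> $ j + U j \<omega> * Z \<omega> $ i + Z \<omega> $ i * Z \<omega> $ j \<partial>P)"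
    by (intro Bochner_Integration.integral_cong) (auto simp: algebra_simps)
  also have "\<dots> = (\<integral>\<omega>. U i \<omega> * U j \<omega> \<partial>P) + (\<integral>\<omega>. Z \<omega> $ i * Z \<omega> $ j \<partial>P)"
    using L2_mult_integrable[OF U U] L2_mult_integrable[OF U Z] L2_mult_integrable[OF Z Z] by (simp add: UZ)
  finally show ?thesis unfolding UU .
qed

text \<open>The grid points of all N form a countable set, so one null set serves for all of them.
  Outside it X may be replaced on the grids by y, which satisfies the integral equation at every s
  by its definition.\<close>

lemma linear_sde_riemann_sums:
  assumes A: "continuous_on {0..L} A" and M: "fundamental_matrix A {0..L} M" and L: "0 \<le> L"
    and cont: "AE \<omega> in P. continuous_on {0..L} (\<lambda>s. \<psi> s \<omega>)"
    and X: "\<And>s. s \<in> {0..L} \<Longrightarrow> AE \<omega> in P. \<psi> s \<omega> = \<psi> 0 \<omega> + integral {0..s} (\<lambda>r. A r *v \<psi> r \<omega>) + X s \<omega>"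
  shows "AE \<omega> in P. (\<lambda>N. \<Sum>k<Suc N. M L (uniform_grid L N (Suc k)) *v
    (X (uniform_grid L N (Suc k)) \<omega> - X (uniform_grid L N k) \<omega>)) \<longlonglongrightarrow> \<psi> L \<omega> - M L 0 *v \<psi> 0 \<omega>"
proof -
  have "AE \<omega> in P. \<forall>N. \<forall>k\<in>{..Suc N}. \<psi> (uniform_grid L N k) \<omega> =
      \<psi> 0 \<omega> + integral {0..uniform_grid L N k} (\<lambda>r. A r *v \<psi> r \<omega>) + X (uniform_grid L N k) \<omega>"
    unfolding AE_all_countable
    by (intro allI AE_finite_allI X uniform_grid_in[OF L]) auto
  with cont show ?thesis
  proof eventually_elim
    case (elim \<omega>)
    define y where "y s = \<psi> s \<omega> - \<psi> 0 \<omega> - integral {0..s} (\<lambda>r. A r *v \<psi> r \<omega>)" for s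
    have "X (uniform_grid L N k) \<omega> = y (uniform_grid L N k)" if "k \<le> Suc N" for N k
      using elim(2) that by (simp add: y_def)
    then have "(\<Sum>k<Suc N. M L (uniform_grid L N (Suc k)) *v (X (uniform_grid L N (Suc k)) \<omega> - X (uniform_grid L N k) \<omega>))
        = (\<Sum>k<Suc N. M L (uniform_grid L N (Suc k)) *v (y (uniform_grid L N (Suc k)) - y (uniform_grid L N k)))" for N
      by (intro sum.cong) auto
    moreover have "(\<lambda>N. \<Sum>k<Suc N. M L (uniform_grid L N (Suc k)) *v (y (uniform_grid L N (Suc k)) - y (uniform_grid L N k)))
        \<longlonglongrightarrow> \<psi> L \<omega> - M L 0 *v \<psi> 0 \<omega>"
      by (rule variation_of_constants_rough[OF A M L elim(1)]) (simp add: y_def)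
    ultimately show ?case by (simp only:)
  qed
qed

lemma fundamental_matrix_continuous_backward:
  assumes A: "continuous_on {0..L} A" and M: "fundamental_matrix A {0..L} M" and L: "0 \<le> L"
  shows "continuous_on {0..L} (M L)"
  using fundamental_matrix_backward_deriv[OF A M L, of L] L by (intro continuous_on_vector_derivative) auto

text \<open>Formulated for a general coefficient \<sigma> and entrywise, with \<sigma>^2 left as it
  is. The square integrability of \<sigma>, extracted from the stochastic equation, is what later
  makes the weighted Gram integral converge.\<close>

theorem linear_sde_covariance:
  assumes prob: "prob_space P" and bm: "standard_brownian_motion P B"
    and A: "continuous_on {0..L} A" and M: "fundamental_matrix A {0..L} M" and L: "0 \<le> L"
    and sde: "solves_linear_sde P B A \<sigma> L \<psi>"
    and init: "square_integrable P (\<psi> 0)" and indep: "independent_of_process P (\<psi> 0) B"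
  shows "square_integrable P (\<psi> L)"
    and "covariance_matrix P (\<psi> L) $ i $ j = (M L 0 ** covariance_matrix P (\<psi> 0) ** transpose (M L 0)) $ i $ j
      + (\<integral>s. (\<sigma> s)\<^sup>2 * (M L s ** transpose (M L s)) $ i $ j \<partial>lebesgue_on {0..L})"
    and "L2 (lebesgue_on {0..L}) \<sigma>"
proof -
  interpret prob_space P by (rule prob)
  have \<psi>m: "\<psi> s \<in> borel_measurable P" if "s \<in> {0..L}" for s
    using sde that by (simp add: solves_linear_sde_def)
  have cont: "AE \<omega> in P. continuous_on {0..L} (\<lambda>s. \<psi> s \<omega>)"
    using sde by (simp add: solves_linear_sde_def)
  have "\<forall>s\<in>{0..L}. \<exists>X. has_wiener_integral P B \<sigma> s X \<and>
      (AE \<omega> in P. \<psi> s \<omega> = \<psi> 0 \<omega> + integral {0..s} (\<lambda>r. A r *v \<psi> r \<omega>) + X \<omega>)"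
    using sde by (simp add: solves_linear_sde_def)
  from bchoice[OF this] obtain X where
    W: "\<And>s. s \<in> {0..L} \<Longrightarrow> has_wiener_integral P B \<sigma> s (X s)" and
    X: "\<And>s. s \<in> {0..L} \<Longrightarrow> AE \<omega> in P. \<psi> s \<omega> = \<psi> 0 \<omega> + integral {0..s} (\<lambda>r. A r *v \<psi> r \<omega>) + X s \<omega>"
    by blast
  have LL: "L \<in> {0..L}" "0 \<in> {0..L}" using L by auto
  show \<sigma>: "L2 (lebesgue_on {0..L}) \<sigma>"
    by (rule wiener_integrand_L2[OF prob bm W[OF LL(1)]])
  let ?\<mu> = "density (lebesgue_on {0..L}) (\<lambda>x. ennreal ((\<sigma> x)\<^sup>2))"
  define Z where "Z \<omega> = \<psi> L \<omega> - M L 0 *v \<psi> 0 \<omega>" for \<omega>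
  have Zm: "Z \<in> borel_measurable P"
    unfolding Z_def[abs_def] using \<psi>m LL
    by (intro borel_measurable_diff measurable_compose[OF \<psi>m[OF LL(2)]] borel_measurable_continuous_onI
        matrix_vector_mult_linear_continuous_on) auto
  have mc: "continuous_on {0..L} (M L)"
    by (rule fundamental_matrix_continuous_backward[OF A M L])
  have lim: "AE \<omega> in P. (\<lambda>N. \<Sum>k<Suc N. M L (uniform_grid L N (Suc k)) *v
      (X (uniform_grid L N (Suc k)) \<omega> - X (uniform_grid L N k) \<omega>)) \<longlonglongrightarrow> Z \<omega>"
    unfolding Z_def by (rule linear_sde_riemann_sums[OF A M L cont X])
  have OI: "orthogonal_increments P X L ?\<mu>"
    by (rule wiener_integral_orthogonal_increments[OF prob bm W L])
  interpret Z: matrix_wiener_limit P X L ?\<mu> "M L" Z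
    using OI L finite_measure_density_square[OF \<sigma>] mc Zm lim by (rule matrix_wiener_limit.intro)
  have Z2: "L2 P (\<lambda>\<omega>. Z \<omega> $ i)" for i
    by (rule Z.matrix_integral_L2)
  \<comment> \<open>Applied below with g = 1 for the mean of Z and with g a component of
    \<open>\<psi> 0\<close> for the cross covariance.\<close>
  have orth: "(\<integral>\<omega>. g \<omega> * Z \<omega> $ i \<partial>P) = 0"
    if g: "L2 P g" and gB: "\<And>r i. 0 \<le> r \<Longrightarrow> (\<integral>\<omega>. g \<omega> * B r \<omega> $ i \<partial>P) = 0" for g i
  proof (rule Z.matrix_integral_orthogonal[OF g])
    show "(\<integral>\<omega>. g \<omega> * X s \<omega> $ i \<partial>P) = 0" if "s \<in> {0..L}" for s i
      by (rule wiener_integral_orthogonal[OF prob bm W[OF that] _ g gB]) (use that in auto)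
  qed
  have init2: "\<And>k. L2 P (\<lambda>\<omega>. \<psi> 0 \<omega> $ k)" and initm: "\<psi> 0 \<in> borel_measurable P"
    using init by (auto simp: square_integrable_iff_L2)
  have mean: "(\<integral>\<omega>. Z \<omega> $ i \<partial>P) = 0" for i
    using orth[of "\<lambda>_. 1"] brownian_nth(2)[OF prob bm] by (simp add: L2_def)
  have cross: "(\<integral>\<omega>. \<psi> 0 \<omega> $ k * Z \<omega> $ i \<partial>P) = 0" for k i
    by (rule orth[OF init2]) (rule brownian_independent_orthogonal[OF prob bm indep initm init2])
  have decomp: "\<psi> L = (\<lambda>\<omega>. M L 0 *v \<psi> 0 \<omega> + Z \<omega>)"
    by (simp add: Z_def)
  have "L2 P (\<lambda>\<omega>. \<psi> L \<omega> $ i)" for i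
    unfolding decomp by (simp add: matrix_vector_mult_def) (intro L2_add L2_sum L2_cmult init2 Z2)
  then show "square_integrable P (\<psi> L)"
    using \<psi>m[OF LL(1)] by (simp add: square_integrable_iff_L2)
  have [measurable]: "\<sigma> \<in> borel_measurable (lebesgue_on {0..L})" by (rule L2_measurable[OF \<sigma>])
  have mm: "(\<lambda>x. M L x $ i $ p) \<in> borel_measurable (lebesgue_on {0..L})" for i p
    by (intro continuous_imp_measurable_on_sets_lebesgue continuous_intros mc) auto
  have indm [measurable]: "indicat_real {0<..L} \<in> borel_measurable (lebesgue_on {0..L})"
    by (intro measurable_restrict_space1 measurable_completion) simp
  have covZ: "(\<integral>\<omega>. Z \<omega> $ i * Z \<omega> $ j \<partial>P) =
      (\<integral>s. (\<sigma> s)\<^sup>2 * (M L s ** transpose (M L s)) $ i $ j \<partial>lebesgue_on {0..L})"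
  proof -
    let ?u = "\<lambda>i p x. M L x $ i $ p * indicator {0<..L} x"
    have um: "?u i p \<in> borel_measurable (lebesgue_on {0..L})" for i p
      using mm[of i p] by measurable
    have u2: "L2 ?\<mu> (?u i p)" for i p
      using Z.L2_matrix_integrand[of i p] by (simp add: Z.matrix_integrand_def[abs_def])
    have int: "integrable (lebesgue_on {0..L}) (\<lambda>x. (\<sigma> x)\<^sup>2 *\<^sub>R (?u i p x * ?u j p x))" for p
      using L2_mult_integrable[OF u2 u2, of i p j p] um[of i p] um[of j p]
      by (subst (asm) integrable_density) auto
    have "(\<integral>\<omega>. Z \<omega> $ i * Z \<omega> $ j \<partial>P) = (\<Sum>p\<in>UNIV. \<integral>x. ?u i p x * ?u j p x \<partial>?\<mu>)"
      by (rule Z.matrix_integral_covariance)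
    also have "\<dots> = (\<Sum>p\<in>UNIV. \<integral>x. (\<sigma> x)\<^sup>2 *\<^sub>R (?u i p x * ?u j p x) \<partial>lebesgue_on {0..L})"
      using um by (intro sum.cong refl integral_density) auto
    also have "\<dots> = (\<integral>x. (\<Sum>p\<in>UNIV. (\<sigma> x)\<^sup>2 *\<^sub>R (?u i p x * ?u j p x)) \<partial>lebesgue_on {0..L})"
      using int by (rule Bochner_Integration.integral_sum[symmetric])
    also have "\<dots> = (\<integral>s. (\<sigma> s)\<^sup>2 * (M L s ** transpose (M L s)) $ i $ j \<partial>lebesgue_on {0..L})"
    proof (rule integral_cong_AE)
      \<comment> \<open>The cutoff at \<open>{0<..L}\<close> differs from 1 on \<open>{0..L}\<close>
        only at the null point 0.\<close>
      have "AE x in lebesgue. x \<noteq> (0::real)"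
        by (intro AE_completion AE_lborel_singleton)
      then have "AE x in lebesgue_on {0..L}. x \<noteq> 0"
        by (auto simp: AE_restrict_space_iff elim: eventually_mono)
      moreover have "AE x in lebesgue_on {0..L}. x \<in> {0..L}"
        by (auto intro: AE_I2)
      ultimately show "AE x in lebesgue_on {0..L}. (\<Sum>p\<in>UNIV. (\<sigma> x)\<^sup>2 *\<^sub>R (?u i p x * ?u j p x)) =
          (\<sigma> x)\<^sup>2 * (M L x ** transpose (M L x)) $ i $ j"
        by eventually_elim (simp add: matrix_matrix_mult_def transpose_def sum_distrib_left)
      show "(\<lambda>x. \<Sum>p\<in>UNIV. (\<sigma> x)\<^sup>2 *\<^sub>R (?u i p x * ?u j p x)) \<in> borel_measurable (lebesgue_on {0..L})"
        using int by (intro borel_measurable_sum) auto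
      show "(\<lambda>x. (\<sigma> x)\<^sup>2 * (M L x ** transpose (M L x)) $ i $ j) \<in> borel_measurable (lebesgue_on {0..L})"
        using mm unfolding matrix_matrix_mult_def transpose_def by simp
    qed
    finally show ?thesis .
  qed
  show "covariance_matrix P (\<psi> L) $ i $ j = (M L 0 ** covariance_matrix P (\<psi> 0) ** transpose (M L 0)) $ i $ j
      + (\<integral>s. (\<sigma> s)\<^sup>2 * (M L s ** transpose (M L s)) $ i $ j \<partial>lebesgue_on {0..L})"
    unfolding decomp covariance_affine[OF prob init2 Z2 mean cross] covZ ..
qed

text \<open>The function \<open>sqrt\<close> extends oddly to negative numbers, so the square of
  \<open>sqrt (2 * D * w s)\<close> is 2 D |w(s)|. The sign condition on w is what turns this into 2
  D w(s) almost everywhere.\<close>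

lemma weighted_gram_integral:
  fixes m :: "real \<Rightarrow> real ^ 'n ^ 'n" and w :: "real \<Rightarrow> real"
  assumes D: "D > 0" and \<sigma>: "L2 (lebesgue_on {0..L}) (\<lambda>s. sqrt (2 * D * w s))"
    and w: "AE s in lebesgue_on {0..L}. w s \<ge> 0" and m: "continuous_on {0..L} m"
  shows "(\<lambda>s. w s *\<^sub>R (m s ** transpose (m s))) absolutely_integrable_on {0..L}"
    and "2 * D * integral {0..L} (\<lambda>s. w s *\<^sub>R (m s ** transpose (m s))) $ i $ j =
      (\<integral>s. (sqrt (2 * D * w s))\<^sup>2 * (m s ** transpose (m s)) $ i $ j \<partial>lebesgue_on {0..L})"
proof -
  let ?l = "lebesgue_on {0..L}" and ?\<sigma> = "\<lambda>s. sqrt (2 * D * w s)"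
  define Q where "Q s = m s ** transpose (m s)" for s
  have Q: "continuous_on {0..L} Q"
    unfolding Q_def matrix_matrix_mult_def transpose_def by (intro continuous_intros m)
  have sq: "(?\<sigma> s)\<^sup>2 = 2 * D * \<bar>w s\<bar>" for s
    using D by (simp only: power2_eq_square real_sqrt_mult_self abs_mult)
  have \<sigma>m: "?\<sigma> \<in> borel_measurable ?l" by (rule L2_measurable[OF \<sigma>])
  \<comment> \<open>Since \<open>sqrt\<close> is odd, w can be recovered from the coefficient at
    every point, whatever its sign, and so inherits measurability.\<close>
  have w_eq: "w s = ?\<sigma> s * \<bar>?\<sigma> s\<bar> / (2 * D)" for s
  proof -
    have "sqrt x * \<bar>sqrt x\<bar> = x" for x :: real
      by (simp add: abs_if)
    then show ?thesis using D by simp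
  qed
  have "(\<lambda>s. ?\<sigma> s * \<bar>?\<sigma> s\<bar> / (2 * D)) \<in> borel_measurable ?l"
    using \<sigma>m by measurable
  then have wm: "w \<in> borel_measurable ?l"
    by (simp only: w_eq[symmetric])
  have Qm: "Q \<in> borel_measurable ?l"
    by (intro continuous_imp_measurable_on_sets_lebesgue Q) auto
  obtain C where C: "\<And>s. s \<in> {0..L} \<Longrightarrow> norm (Q s) \<le> C"
    using compact_imp_bounded[OF compact_continuous_image[OF Q compact_Icc]]
    unfolding bounded_iff by blast
  \<comment> \<open>The dominating function is |w(s)| C, written through the square-integrable
    coefficient; this explains the factor C / (2 D).\<close>
  have "integrable ?l (\<lambda>s. (?\<sigma> s)\<^sup>2 * (C / (2 * D)))"
    using \<sigma> unfolding L2_def by (intro integrable_mult_left) simp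
  then have int: "integrable ?l (\<lambda>s. w s *\<^sub>R Q s)"
  proof (rule Bochner_Integration.integrable_bound)
    show "(\<lambda>s. w s *\<^sub>R Q s) \<in> borel_measurable ?l"
      using wm Qm by measurable
    have "\<bar>w s\<bar> * norm (Q s) \<le> \<bar>\<bar>w s\<bar> * C\<bar>" if "s \<in> {0..L}" for s
      using mult_left_mono[OF C[OF that], of "\<bar>w s\<bar>"] by linarith
    then show "AE s in ?l. norm (w s *\<^sub>R Q s) \<le> norm ((?\<sigma> s)\<^sup>2 * (C / (2 * D)))"
      unfolding sq using D by (intro AE_I2) simp
  qed
  then show "(\<lambda>s. w s *\<^sub>R (m s ** transpose (m s))) absolutely_integrable_on {0..L}"
    by (simp add: set_integrable_def integrable_restrict_space Q_def)
  have lin: "bounded_linear (\<lambda>X :: real ^ 'n ^ 'n. X $ i $ j)"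
    using bounded_linear_compose[OF bounded_linear_vec_nth bounded_linear_vec_nth] .
  have "integral {0..L} (\<lambda>s. w s *\<^sub>R Q s) $ i $ j = (\<integral>s. w s *\<^sub>R Q s \<partial>?l) $ i $ j"
    using int by (simp add: lebesgue_integral_eq_integral)
  also have "\<dots> = (\<integral>s. w s * Q s $ i $ j \<partial>?l)"
    using integral_bounded_linear[OF lin int] by simp
  finally have "2 * D * integral {0..L} (\<lambda>s. w s *\<^sub>R Q s) $ i $ j = (\<integral>s. 2 * D * (w s * Q s $ i $ j) \<partial>?l)"
    by simp
  also have "\<dots> = (\<integral>s. (?\<sigma> s)\<^sup>2 * Q s $ i $ j \<partial>?l)"
  proof (rule integral_cong_AE)
    have Qc: "(\<lambda>s. Q s $ i $ j) \<in> borel_measurable ?l"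
      by (intro continuous_imp_measurable_on_sets_lebesgue continuous_intros Q) auto
    show "(\<lambda>s. 2 * D * (w s * Q s $ i $ j)) \<in> borel_measurable ?l"
      "(\<lambda>s. (?\<sigma> s)\<^sup>2 * Q s $ i $ j) \<in> borel_measurable ?l"
      using wm \<sigma>m Qc by measurable
    show "AE s in ?l. 2 * D * (w s * Q s $ i $ j) = (?\<sigma> s)\<^sup>2 * Q s $ i $ j"
      using w unfolding sq by eventually_elim simp
  qed
  finally show "2 * D * integral {0..L} (\<lambda>s. w s *\<^sub>R (m s ** transpose (m s))) $ i $ j =
      (\<integral>s. (?\<sigma> s)\<^sup>2 * (m s ** transpose (m s)) $ i $ j \<partial>?l)"
    unfolding Q_def .
qed

theorem mainTheorem5:
  fixes G :: "real ^ 'n ^ 'n"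
    and F :: "real ^ 'n \<Rightarrow> real ^ 'n"
    and T D :: real
    and K S t w :: "real \<Rightarrow> real"
    and \<theta>\<^sub>0 :: "real ^ 'n"
    and \<theta> :: "real \<Rightarrow> real ^ 'n"
    and A :: "real \<Rightarrow> real ^ 'n ^ 'n"
    and M :: "real \<Rightarrow> real \<Rightarrow> real ^ 'n ^ 'n"
    and P :: "'a measure"
    and B \<psi> :: "real \<Rightarrow> 'a \<Rightarrow> real ^ 'n"
  assumes graph: "connected_weighted_adjacency G"
    and F: "F = coupling_field G"
    and T: "T > 0"
    and D: "D > 0"
    and K_integrable: "K absolutely_integrable_on {0..T}"
    and K_pos: "AE r in lebesgue_on {0..T}. K r > 0"
    and S: "S = (\<lambda>r. integral {0..r} K)"
    and t: "t = the_inv_into {0..T} S"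
    and w: "w = (\<lambda>s. 1 / K (t s))"
    and orbit: "\<forall>s\<in>{0..S T}. (\<theta> has_vector_derivative F (\<theta> s)) (at s within {0..S T})"
    and orbit_init: "\<theta> 0 = \<theta>\<^sub>0"
    and A: "A = (\<lambda>s. jacobian F (at (\<theta> s)))"
    and M: "fundamental_matrix A {0..S T} M"
    and P: "prob_space P"
    and B: "standard_brownian_motion P B"
    and sde: "solves_linear_sde P B A (\<lambda>s. sqrt (2 * D * w s)) (S T) \<psi>"
    and init_L2: "square_integrable P (\<psi> 0)"
    and init_indep: "independent_of_process P (\<psi> 0) B"
  shows "square_integrable P (\<psi> (S T)) \<and>
    (\<lambda>s. w s *\<^sub>R (M (S T) s ** transpose (M (S T) s))) absolutely_integrable_on {0..S T} \<and>
    covariance_matrix P (\<psi> (S T)) =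
      M (S T) 0 ** covariance_matrix P (\<psi> 0) ** transpose (M (S T) 0)
      + (2 * D) *\<^sub>R integral {0..S T} (\<lambda>s. w s *\<^sub>R (M (S T) s ** transpose (M (S T) s)))"
proof -
  have L: "0 \<le> S T"
    using clock_nonneg[OF K_integrable K_pos _ S] T by simp
  have "continuous_on {0..S T} \<theta>"
    using orbit by (intro continuous_on_vector_derivative) auto
  then have cA: "continuous_on {0..S T} A"
    unfolding A F by (rule continuous_on_jacobian_coupling_field)
  have "AE s in lebesgue_on {0..S T}. K (t s) > 0"
    using clock_inverse_AE_pos[OF K_integrable K_pos _ S t] T by simp
  then have w_nonneg: "AE s in lebesgue_on {0..S T}. w s \<ge> 0"
    unfolding w by (rule eventually_mono) simp
  note cov = linear_sde_covariance[OF P B cA M L sde init_L2 init_indep]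
  note gram = weighted_gram_integral[OF D cov(3) w_nonneg fundamental_matrix_continuous_backward[OF cA M L]]
  have "covariance_matrix P (\<psi> (S T)) =
      M (S T) 0 ** covariance_matrix P (\<psi> 0) ** transpose (M (S T) 0)
      + (2 * D) *\<^sub>R integral {0..S T} (\<lambda>s. w s *\<^sub>R (M (S T) s ** transpose (M (S T) s)))"
    by (simp add: vec_eq_iff cov(2) gram(2))
  with cov(1) gram(1) show ?thesis by blast
qed

end
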